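(* Let $\mu,\nu$ be probability measures on $\mathbb{R}$ with $\mu\preceq_C\nu$ (convex order), and let $c(x,y)=h(y-x)$ for some twice continuously differentiable function $h:\mathbb{R}\to\mathbb{R}$, such that $c$ satisfies the sufficient integrability condition with respect to $\mu,\nu$. Let $k\in\mathbb{N}$ be such that the graph of every affine function $x\mapsto ax+b$ meets the graph of $h'$ in at most $k$ points. If $\pi\in\Pi_M(\mu,\nu)$ is an optimal martingale transport plan (a minimizer of $\pi'\mapsto\iint c\,d\pi'$ over $\Pi_M(\mu,\nu)$) with finite cost, then there exists a disintegration $(\pi_x)_{x\in\mathbb{R}}$ of $\pi$ with respect to $\mu$ such that for every $x\in\mathbb{R}$ at least one of the following holds: $$\mu(\{x\})>0\quad\text{or}\quad \operatorname{card}(\operatorname{spt}(\pi_x))\le k.$$ In particular, if $\mu$ is continuous (has no atoms), then $\operatorname{card}(\operatorname{spt}(\pi_x))\le k$ holds for $\mu$-a.e. $x$, for any disintegration of $\pi$.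
   Context: Convex order: two finite Borel measures $\mu,\nu$ on $\mathbb{R}$ with finite first moments satisfy $\mu\preceq_C\nu$ if $\int\varphi\,d\mu\le\int\varphi\,d\nu$ for every convex $\varphi:\mathbb{R}\to\mathbb{R}$. $\Pi_M(\mu,\nu)$ (martingale transport plans) is the set of Borel measures $\pi$ on $\mathbb{R}\times\mathbb{R}$ with first marginal $\mu$, second marginal $\nu$, whose disintegration $(\pi_x)_{x\in\mathbb{R}}$ into probability measures with respect to $\mu$ satisfies $\int y\,d\pi_x(y)=x$ for $\mu$-a.e. $x$. Sufficient integrability condition: $c(x,y)\ge a(x)+b(y)$ for all $x,y$, where $a$ is $\mu$-integrable and $b$ is $\nu$-integrable. *)

theory Defs
  imports "HOL-Probability.Probability"
begin

text \<open>
  Integral with values in the extended reals. It agrees with the Bochner integral on integrable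
  functions, and is infinite (rather than 0, as the Bochner integral would be) when exactly one of
  the positive and negative parts has infinite integral. It is only meaningful when at most one of
  them has (for both infinite, ereal subtraction yields \<open>\<infinity>\<close>).
\<close>
definition ext_integral :: "'a measure \<Rightarrow> ('a \<Rightarrow> real) \<Rightarrow> ereal" where
  "ext_integral M f =
     enn2ereal (\<integral>\<^sup>+ x. ennreal (f x) \<partial>M) - enn2ereal (\<integral>\<^sup>+ x. ennreal (- f x) \<partial>M)"

text \<open>
  A convex function is bounded below by an affine one, so its negative part is integrable under
  the first-moment assumption; both sides of the inequality may be \<open>\<infinity>\<close>.
\<close>
definition convex_order :: "real measure \<Rightarrow> real measure \<Rightarrow> bool" where
  "convex_order \<mu> \<nu> \<longleftrightarrow>
     finite_measure \<mu> \<and> sets \<mu> = sets borel \<and> integrable \<mu> (\<lambda>x. x) \<and>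
     finite_measure \<nu> \<and> sets \<nu> = sets borel \<and> integrable \<nu> (\<lambda>x. x) \<and>
     (\<forall>\<phi>. convex_on UNIV \<phi> \<longrightarrow> ext_integral \<mu> \<phi> \<le> ext_integral \<nu> \<phi>)"

text \<open>
  Measurability into \<^const>\<open>prob_algebra\<close> says that every \<open>\<kappa> x\<close> is a Borel probability measure and
  that \<open>x \<mapsto> \<kappa> x B\<close> is Borel for every Borel set \<open>B\<close>.
\<close>
definition disintegration ::
    "(real \<times> real) measure \<Rightarrow> real measure \<Rightarrow> (real \<Rightarrow> real measure) \<Rightarrow> bool" where
  "disintegration \<pi> \<mu> \<kappa> \<longleftrightarrow>
     \<kappa> \<in> borel \<rightarrow>\<^sub>M prob_algebra borel \<and>
     (\<forall>S \<in> sets borel. emeasure \<pi> S = (\<integral>\<^sup>+ x. emeasure (\<kappa> x) {y. (x, y) \<in> S} \<partial>\<mu>))"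

text \<open>
  Disintegrations are unique up to \<open>\<mu>\<close>-null sets, so the barycentre condition does not depend on
  which one is chosen.
\<close>
definition martingale_plans :: "real measure \<Rightarrow> real measure \<Rightarrow> (real \<times> real) measure set" where
  "martingale_plans \<mu> \<nu> = {\<pi>.
     sets \<pi> = sets borel \<and> distr \<pi> borel fst = \<mu> \<and> distr \<pi> borel snd = \<nu> \<and>
     (\<exists>\<kappa>. disintegration \<pi> \<mu> \<kappa> \<and>
          (AE x in \<mu>. integrable (\<kappa> x) (\<lambda>y. y) \<and> (\<integral>y. y \<partial>\<kappa> x) = x))}"

definition transport_cost :: "(real \<Rightarrow> real \<Rightarrow> real) \<Rightarrow> (real \<times> real) measure \<Rightarrow> ereal" where
  "transport_cost c \<pi> = ext_integral \<pi> (\<lambda>(x, y). c x y)"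

definition optimal_martingale_plan ::
    "(real \<Rightarrow> real \<Rightarrow> real) \<Rightarrow> real measure \<Rightarrow> real measure \<Rightarrow> (real \<times> real) measure \<Rightarrow> bool" where
  "optimal_martingale_plan c \<mu> \<nu> \<pi> \<longleftrightarrow>
     \<pi> \<in> martingale_plans \<mu> \<nu> \<and>
     (\<forall>\<pi>' \<in> martingale_plans \<mu> \<nu>. transport_cost c \<pi> \<le> transport_cost c \<pi>')"

definition sufficient_integrability ::
    "(real \<Rightarrow> real \<Rightarrow> real) \<Rightarrow> real measure \<Rightarrow> real measure \<Rightarrow> bool" where
  "sufficient_integrability c \<mu> \<nu> \<longleftrightarrow>
     (\<exists>a b. integrable \<mu> a \<and> integrable \<nu> b \<and> (\<forall>x y. c x y \<ge> a x + b y))"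

definition twice_continuously_differentiable :: "(real \<Rightarrow> real) \<Rightarrow> bool" where
  "twice_continuously_differentiable h \<longleftrightarrow>
     h differentiable_on UNIV \<and> deriv h differentiable_on UNIV \<and>
     continuous_on UNIV (deriv (deriv h))"

definition graph_of :: "(real \<Rightarrow> real) \<Rightarrow> (real \<times> real) set" where
  "graph_of f = {(x, f x) | x. True}"

definition spt :: "'a::topological_space measure \<Rightarrow> 'a set" where
  "spt M = {x. \<forall>U. open U \<and> x \<in> U \<longrightarrow> emeasure M U > 0}"

end

theory Submission
  imports Defs
begin

text \<open>
  If more than \<open>k\<close> points lie in the support of \<open>\<pi>\<^sub>x\<close>, three of them, \<open>y\<^sub>0 < y\<^sub>1 < y\<^sub>2\<close>, satisfy
  that the points of the graph of \<open>h'(\<cdot> - x)\<close> above them are not collinear. By continuity there are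
  rational intervals \<open>J \<ni> x\<close>, \<open>I\<^sub>i \<ni> y\<^sub>i\<close> and an affine \<open>l\<close> such that, for all \<open>s \<in> J\<close>,
  \<open>h'(y - s) - l(y)\<close> has one strict sign on \<open>I\<^sub>1\<close> and the other one on \<open>I\<^sub>0\<close> and \<open>I\<^sub>2\<close>. There are
  countably many such boxes, so if the claim fails, one box works for a set \<open>B \<subseteq> J\<close> of
  positive \<open>\<mu>\<close>-measure without atoms. A point \<open>m\<close> splits \<open>B\<close> into two parts of positive measure.
  Exchange mass between the parts: over the one, move mass from \<open>I\<^sub>1\<close> to \<open>I\<^sub>0 \<union> I\<^sub>2\<close>, over the other
  one, from \<open>I\<^sub>0 \<union> I\<^sub>2\<close> to \<open>I\<^sub>1\<close>, preserving both marginals and all barycentres. The cost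
  \<open>h(y - x)\<close> may then be replaced by \<open>h(y - x) - h(y - m) - (m - x) l(y)\<close>, which equals
  \<open>(m - x) (h'(y - s) - l(y))\<close> for some \<open>s \<in> J\<close>; hence, for the right choice of the two parts, every
  piece of removed mass has positive cost and every piece of added mass negative cost,
  contradicting optimality.
\<close>

subsection \<open>Sums of measures and extended integrals\<close>

text \<open>The obstacle is exactness: the exchange has to preserve the second marginal and, over
  every x, both mass and barycentre, while the kernels are arbitrary on the intervals and vary with
  x. Two observations resolve this. Over one part of \<open>B\<close> mass is removed from both
  outer intervals, so its proportions can be tuned fibre by fibre until all fibres have one common
  barycentre \<open>r\<close>; a single profile on \<open>I1\<close> with barycentre
  \<open>r\<close> then fits all of them. Over the other part the fibres lose mass from
  \<open>I1\<close> with varying barycentres, and two weights, one for \<open>I0\<close> and one for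
  \<open>I2\<close>, suffice to match mass and barycentre. Everything added is a density with
  respect to the product of \<mu> and the second marginal of the removed part, so the competitor
  comes with an explicit kernel, and bounded intervals keep all terms integrable. Atoms are excluded
  because mass at a single x cannot be placed on two sides of m, where the factor m - x has opposite
  signs.\<close>

definition add_measure :: "'a measure \<Rightarrow> 'a measure \<Rightarrow> 'a measure" where
  "add_measure M N = measure_of (space M) (sets M) (\<lambda>A. emeasure M A + emeasure N A)"

lemma sets_add_measure [simp, measurable_cong]: "sets (add_measure M N) = sets M"
  by (simp add: add_measure_def)

lemma space_add_measure [simp]: "space (add_measure M N) = space M"
  by (simp add: add_measure_def)

text \<open>\<open>add_measure\<close> carries the sigma-algebra of its first argument. If the
  second summand lived on another one, the sum could fail to be countably additive, and
  \<open>measure_of\<close> would fall back to the zero measure.\<close>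

lemma emeasure_add_measure:
  assumes "sets N = sets M" and "A \<in> sets M"
  shows "emeasure (add_measure M N) A = emeasure M A + emeasure N A"
  unfolding add_measure_def
proof (rule emeasure_measure_of_sigma)
  show "sigma_algebra (space M) (sets M)"
    by (rule sets.sigma_algebra_axioms)
  show "positive (sets M) (\<lambda>A. emeasure M A + emeasure N A)"
    by (simp add: positive_def)
  show "countably_additive (sets M) (\<lambda>A. emeasure M A + emeasure N A)"
  proof (rule countably_additiveI)
    fix A :: "nat \<Rightarrow> _"
    assume *: "range A \<subseteq> sets M" "disjoint_family A"
    then show "(\<Sum>i. emeasure M (A i) + emeasure N (A i)) =
        emeasure M (\<Union>i. A i) + emeasure N (\<Union>i. A i)"
      using suminf_emeasure[OF *] suminf_emeasure[of A N] assms
      by (subst suminf_add[symmetric]) auto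
  qed
qed (fact assms)

lemma nn_integral_add_measure:
  assumes N: "sets N = sets M" and "f \<in> borel_measurable M"
  shows "(\<integral>\<^sup>+ x. f x \<partial>add_measure M N) = (\<integral>\<^sup>+ x. f x \<partial>M) + (\<integral>\<^sup>+ x. f x \<partial>N)"
  using assms(2)
proof (induction rule: borel_measurable_induct)
  case (cong f g)
  have eq: "integral\<^sup>N L f = integral\<^sup>N L g" if "space L = space M" for L
    using cong.hyps(3) that by (intro nn_integral_cong) auto
  show ?case
    using cong.IH by (simp add: eq sets_eq_imp_space_eq[OF N])
next
  case (set A)
  then show ?case using N by (simp add: emeasure_add_measure)
next
  case (mult u c)
  have [measurable]: "u \<in> borel_measurable N" "u \<in> borel_measurable M"
    using mult N by (simp_all cong: measurable_cong_sets)
  show ?case using mult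
    by (simp add: nn_integral_cmult distrib_left)
next
  case (add u v)
  have [measurable]: "u \<in> borel_measurable N" "v \<in> borel_measurable N"
      "u \<in> borel_measurable M" "v \<in> borel_measurable M"
    using add N by (simp_all cong: measurable_cong_sets)
  show ?case using add by (simp add: nn_integral_add ac_simps)
next
  case (seq U)
  have [measurable]: "U i \<in> borel_measurable N" "U i \<in> borel_measurable M" for i
    using seq N by (simp_all cong: measurable_cong_sets)
  have "(\<integral>\<^sup>+ x. (SUP i. U i x) \<partial>add_measure M N) = (SUP i. integral\<^sup>N (add_measure M N) (U i))"
    by (rule nn_integral_monotone_convergence_SUP) (use seq in auto)
  also have "\<dots> = (SUP i. integral\<^sup>N M (U i) + integral\<^sup>N N (U i))"
    using seq by simp
  also have "\<dots> = (SUP i. integral\<^sup>N M (U i)) + (SUP i. integral\<^sup>N N (U i))"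
    using seq(3) by (intro ennreal_SUP_add) (auto simp: incseq_def le_fun_def intro!: nn_integral_mono)
  also have "\<dots> = (\<integral>\<^sup>+ x. (SUP i. U i x) \<partial>M) + (\<integral>\<^sup>+ x. (SUP i. U i x) \<partial>N)"
    using seq by (simp add: nn_integral_monotone_convergence_SUP)
  finally show ?case by (simp add: SUP_apply[abs_def] image_comp)
qed

lemma integrable_add_measure:
  fixes f :: "'a \<Rightarrow> real"
  assumes N: "sets N = sets M" and "integrable M f" "integrable N f"
  shows "integrable (add_measure M N) f"
    and "(\<integral>x. f x \<partial>add_measure M N) = (\<integral>x. f x \<partial>M) + (\<integral>x. f x \<partial>N)"
proof -
  have [measurable]: "f \<in> borel_measurable M" using assms by auto
  note nn = nn_integral_add_measure[OF N]
  show int: "integrable (add_measure M N) f"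
    using assms(2,3) by (auto simp: integrable_iff_bounded nn less_top)
  \<comment> \<open>With s = 1 and s = -1 the integrand is the positive and the negative part of
    \<open>f\<close>; additivity in the measure is so far known only for nonnegative
    integrands.\<close>
  have "ennreal (\<integral>x. max 0 (s * f x) \<partial>add_measure M N)
      = ennreal ((\<integral>x. max 0 (s * f x) \<partial>M) + (\<integral>x. max 0 (s * f x) \<partial>N))" for s
    using assms int
    by (simp add: nn_integral_eq_integral[symmetric] ennreal_plus nn integral_nonneg)
  then have *: "(\<integral>x. max 0 (s * f x) \<partial>add_measure M N)
      = (\<integral>x. max 0 (s * f x) \<partial>M) + (\<integral>x. max 0 (s * f x) \<partial>N)" for s
    by (subst (asm) ennreal_inj) (auto intro!: integral_nonneg add_nonneg_nonneg)
  have dec: "integral\<^sup>L L f = (\<integral>x. max 0 (1 * f x) \<partial>L) - (\<integral>x. max 0 (-1 * f x) \<partial>L)"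
    if "integrable L f" for L
  proof -
    have "integrable L (\<lambda>x. max 0 (s * f x))" for s
      using that by (intro integrable_max) auto
    note * = this[of 1] this[of "-1"]
    have "integral\<^sup>L L f = (\<integral>x. max 0 (1 * f x) - max 0 (-1 * f x) \<partial>L)"
      by (rule Bochner_Integration.integral_cong) auto
    also have "\<dots> = (\<integral>x. max 0 (1 * f x) \<partial>L) - (\<integral>x. max 0 (-1 * f x) \<partial>L)"
      by (rule Bochner_Integration.integral_diff) (fact *)+
    finally show ?thesis .
  qed
  show "(\<integral>x. f x \<partial>add_measure M N) = (\<integral>x. f x \<partial>M) + (\<integral>x. f x \<partial>N)"
    using *[of 1] *[of "-1"] dec[OF int] dec[OF assms(2)] dec[OF assms(3)] by simp
qed

lemma ext_integral_eq_integral: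
  assumes "integrable M f"
  shows "ext_integral M f = ereal (\<integral>x. f x \<partial>M)"
proof -
  from assms obtain r q where rq: "0 \<le> r" "0 \<le> q"
      "(\<integral>\<^sup>+ x. ennreal (f x) \<partial>M) = ennreal r" "(\<integral>\<^sup>+ x. ennreal (- f x) \<partial>M) = ennreal q"
      "integral\<^sup>L M f = r - q"
    by (rule integrableE)
  show ?thesis unfolding ext_integral_def rq(3-5)
    using rq by simp
qed

text \<open>In \<open>ereal\<close> the difference of two infinities is again infinite, so a finite
  value also rules out the case where both parts diverge.\<close>

lemma integrable_of_ext_integral_finite:
  assumes "f \<in> borel_measurable M" and "\<bar>ext_integral M f\<bar> \<noteq> \<infinity>"
  shows "integrable M f"
proof -
  have "(\<integral>\<^sup>+ x. ennreal (f x) \<partial>M) \<noteq> \<infinity>" "(\<integral>\<^sup>+ x. ennreal (- f x) \<partial>M) \<noteq> \<infinity>"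
    using assms(2) unfolding ext_integral_def
    by (cases "\<integral>\<^sup>+ x. ennreal (f x) \<partial>M"; cases "\<integral>\<^sup>+ x. ennreal (- f x) \<partial>M"; force simp: top_ereal_def)+
  then show ?thesis using assms(1) by (simp add: real_integrable_def)
qed

subsection \<open>Integration along disintegrations\<close>

lemma disintegrationD:
  assumes "disintegration \<pi> \<mu> \<kappa>"
  shows "prob_space (\<kappa> x)" and "sets (\<kappa> x) = sets borel" and "\<kappa> \<in> borel \<rightarrow>\<^sub>M subprob_algebra borel"
proof -
  have k: "\<kappa> \<in> borel \<rightarrow>\<^sub>M prob_algebra borel"
    using assms by (simp add: disintegration_def)
  show "\<kappa> \<in> borel \<rightarrow>\<^sub>M subprob_algebra borel"
    using k by (rule measurable_prob_algebraD)
  show "prob_space (\<kappa> x)" "sets (\<kappa> x) = sets borel"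
    using measurable_space[OF k, of x] by (auto simp: space_prob_algebra)
qed

lemma measurable_kernel_nn_integral:
  fixes f :: "real \<times> real \<Rightarrow> ennreal"
  assumes "disintegration \<pi> \<mu> \<kappa>" and "f \<in> borel_measurable borel"
  shows "(\<lambda>x. \<integral>\<^sup>+ y. f (x, y) \<partial>\<kappa> x) \<in> borel_measurable borel"
  by (rule nn_integral_measurable_subprob_algebra2[OF _ disintegrationD(3)[OF assms(1)]])
    (use assms(2) in \<open>simp add: borel_prod\<close>)

lemma nn_integral_disintegration:
  fixes f :: "real \<times> real \<Rightarrow> ennreal"
  assumes d: "disintegration \<pi> \<mu> \<kappa>" and "sets \<pi> = sets borel" and \<mu>: "sets \<mu> = sets borel"
    and f: "f \<in> borel_measurable borel"
  shows "(\<integral>\<^sup>+ z. f z \<partial>\<pi>) = (\<integral>\<^sup>+ x. \<integral>\<^sup>+ y. f (x, y) \<partial>\<kappa> x \<partial>\<mu>)"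
proof -
  note [measurable_cong] = disintegrationD(2)[OF d]
  \<comment> \<open>\<open>L x\<close> is \<open>\<kappa> x\<close> placed on the vertical fibre
    over x. Then \<pi> is the monadic composition of \<mu> with \<open>L\<close>, and the integral
    formula for \<open>bind\<close> applies.\<close>
  define L where "L x = distr (\<kappa> x) (borel :: (real \<times> real) measure) (Pair x)" for x
  have "L \<in> borel \<rightarrow>\<^sub>M prob_algebra borel"
    unfolding L_def
    by (rule measurable_distr_prob_space2[where M = borel])
      (use d in \<open>auto simp: disintegration_def borel_prod split_beta'\<close>)
  then have L: "L \<in> \<mu> \<rightarrow>\<^sub>M subprob_algebra borel"
    using \<mu> by (auto dest: measurable_prob_algebraD cong: measurable_cong_sets)
  have sp: "space \<mu> = UNIV" using sets_eq_imp_space_eq[OF \<mu>] by simp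
  have pair: "Pair x \<in> \<kappa> x \<rightarrow>\<^sub>M borel" for x
    using disintegrationD(2)[OF d] by (simp add: borel_prod[symmetric] cong: measurable_cong_sets)
  have "\<pi> = \<mu> \<bind> L"
  proof (rule measure_eqI)
    show "sets \<pi> = sets (\<mu> \<bind> L)"
      using sp assms(2) by (subst sets_bind[where N = borel]) (auto simp: L_def)
    fix S assume S: "S \<in> sets \<pi>"
    then have "emeasure \<pi> S = (\<integral>\<^sup>+ x. emeasure (\<kappa> x) {y. (x, y) \<in> S} \<partial>\<mu>)"
      using d assms(2) by (simp add: disintegration_def)
    also have "\<dots> = (\<integral>\<^sup>+ x. emeasure (L x) S \<partial>\<mu>)"
      using S assms(2) pair sets_eq_imp_space_eq[OF disintegrationD(2)[OF d]]
      by (auto simp: L_def emeasure_distr vimage_def intro!: nn_integral_cong)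
    also have "\<dots> = emeasure (\<mu> \<bind> L) S"
      using S assms(2) sp by (subst emeasure_bind[OF _ L]) auto
    finally show "emeasure \<pi> S = emeasure (\<mu> \<bind> L) S" .
  qed
  then have "(\<integral>\<^sup>+ z. f z \<partial>\<pi>) = (\<integral>\<^sup>+ x. \<integral>\<^sup>+ z. f z \<partial>L x \<partial>\<mu>)"
    by (simp add: nn_integral_bind[OF f L])
  also have "\<dots> = (\<integral>\<^sup>+ x. \<integral>\<^sup>+ y. f (x, y) \<partial>\<kappa> x \<partial>\<mu>)"
    using pair f by (simp add: L_def nn_integral_distr)
  finally show ?thesis .
qed

lemma prob_space_disintegration:
  assumes d: "disintegration \<pi> \<mu> \<kappa>" and "sets \<pi> = sets borel"
    and "prob_space \<mu>" and "sets \<mu> = sets borel"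
  shows "prob_space \<pi>"
proof (rule prob_spaceI)
  have "emeasure \<pi> (space \<pi>) = (\<integral>\<^sup>+ x. \<integral>\<^sup>+ y. 1 \<partial>\<kappa> x \<partial>\<mu>)"
    using nn_integral_disintegration[OF d assms(2,4), of "\<lambda>_. 1"] by simp
  then show "emeasure \<pi> (space \<pi>) = 1"
    using prob_space.emeasure_space_1[OF disintegrationD(1)[OF d]]
      prob_space.emeasure_space_1[OF assms(3)] by simp
qed

text \<open>Adding the bound \<open>K\<close> makes f nonnegative and reduces the claim to
  \<open>nn_integral_disintegration\<close>; as all measures involved are probabilities, the shift
  adds the same \<open>K\<close> to both sides.\<close>

lemma integral_disintegration:
  fixes f :: "real \<times> real \<Rightarrow> real"
  assumes d: "disintegration \<pi> \<mu> \<kappa>" and \<pi>: "sets \<pi> = sets borel" and \<mu>: "sets \<mu> = sets borel"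
    and "prob_space \<mu>"
    and f: "f \<in> borel_measurable borel" and bd: "\<And>z. \<bar>f z\<bar> \<le> K"
  shows "(\<lambda>x. \<integral>y. f (x, y) \<partial>\<kappa> x) \<in> borel_measurable borel"
    and "(\<integral>z. f z \<partial>\<pi>) = (\<integral>x. (\<integral>y. f (x, y) \<partial>\<kappa> x) \<partial>\<mu>)"
proof -
  interpret \<mu>: prob_space \<mu> by fact
  interpret \<kappa>: prob_space "\<kappa> x" for x by (rule disintegrationD[OF d])
  have [measurable]: "f \<in> borel_measurable (borel \<Otimes>\<^sub>M borel)" using f by (simp add: borel_prod)
  note [measurable_cong] = disintegrationD(2)[OF d] \<mu>
  interpret \<pi>: prob_space \<pi> by (rule prob_space_disintegration[OF d \<pi> assms(4) \<mu>])
  have f\<pi>: "f \<in> borel_measurable \<pi>" using f \<pi> by (simp cong: measurable_cong_sets)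
  have i\<pi>: "integrable \<pi> f"
    by (rule \<pi>.integrable_const_bound[of _ K]) (use bd f\<pi> in auto)
  have i\<kappa>: "integrable (\<kappa> x) (\<lambda>y. f (x, y))" for x
    by (rule \<kappa>.integrable_const_bound[of _ K]) (use bd in auto)
  have nonneg: "0 \<le> f z + K" for z using bd[of z] by simp
  have nn: "ennreal (\<integral>y. f (x, y) + K \<partial>\<kappa> x) = (\<integral>\<^sup>+ y. ennreal (f (x, y) + K) \<partial>\<kappa> x)" for x
    using i\<kappa> nonneg by (intro nn_integral_eq_integral[symmetric]) auto
  have shift: "(\<integral>y. f (x, y) + K \<partial>\<kappa> x) = (\<integral>y. f (x, y) \<partial>\<kappa> x) + K" for x
    using i\<kappa> \<kappa>.prob_space by simp
  have le: "\<bar>\<integral>y. f (x, y) \<partial>\<kappa> x\<bar> \<le> K" for x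
  proof -
    have "\<bar>\<integral>y. f (x, y) \<partial>\<kappa> x\<bar> \<le> (\<integral>y. \<bar>f (x, y)\<bar> \<partial>\<kappa> x)"
      by (rule integral_abs_bound)
    also have "\<dots> \<le> (\<integral>y. K \<partial>\<kappa> x)"
      by (rule integral_mono) (use i\<kappa> bd in auto)
    finally have "\<bar>\<integral>y. f (x, y) \<partial>\<kappa> x\<bar> \<le> (\<integral>y. K \<partial>\<kappa> x)" .
    then show ?thesis by (simp add: \<kappa>.prob_space)
  qed
  have "(\<lambda>x. \<integral>\<^sup>+ y. ennreal (f (x, y) + K) \<partial>\<kappa> x) \<in> borel_measurable borel"
    using f by (intro measurable_kernel_nn_integral[OF d]) simp
  then have "(\<lambda>x. enn2real (ennreal ((\<integral>y. f (x, y) \<partial>\<kappa> x) + K)) - K) \<in> borel_measurable borel"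
    unfolding nn[symmetric] shift by simp
  moreover have "enn2real (ennreal ((\<integral>y. f (x, y) \<partial>\<kappa> x) + K)) - K = (\<integral>y. f (x, y) \<partial>\<kappa> x)" for x
    using le[of x] by (simp add: enn2real_ennreal)
  ultimately show m: "(\<lambda>x. \<integral>y. f (x, y) \<partial>\<kappa> x) \<in> borel_measurable borel" by simp
  then have i\<mu>: "integrable \<mu> (\<lambda>x. \<integral>y. f (x, y) \<partial>\<kappa> x)"
    by (intro \<mu>.integrable_const_bound[of _ K]) (use le in auto)
  have nonneg': "0 \<le> (\<integral>y. f (x, y) \<partial>\<kappa> x) + K" for x
    using le[of x] by auto
  have "ennreal (\<integral>z. f z + K \<partial>\<pi>) = (\<integral>\<^sup>+ z. ennreal (f z + K) \<partial>\<pi>)"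
    using i\<pi> nonneg by (intro nn_integral_eq_integral[symmetric]) auto
  also have "\<dots> = (\<integral>\<^sup>+ x. ennreal ((\<integral>y. f (x, y) \<partial>\<kappa> x) + K) \<partial>\<mu>)"
    using f by (subst nn_integral_disintegration[OF d \<pi> \<mu>]) (auto simp: nn[symmetric] shift)
  also have "\<dots> = ennreal (\<integral>x. (\<integral>y. f (x, y) \<partial>\<kappa> x) + K \<partial>\<mu>)"
    using i\<mu> nonneg' by (intro nn_integral_eq_integral) auto
  finally have "(\<integral>z. f z + K \<partial>\<pi>) = (\<integral>x. (\<integral>y. f (x, y) \<partial>\<kappa> x) + K \<partial>\<mu>)"
    using nonneg nonneg' by (subst (asm) ennreal_inj) (auto intro!: integral_nonneg)
  then show "(\<integral>z. f z \<partial>\<pi>) = (\<integral>x. (\<integral>y. f (x, y) \<partial>\<kappa> x) \<partial>\<mu>)"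
    using i\<pi> i\<mu> \<pi>.prob_space \<mu>.prob_space by simp
qed

subsection \<open>Perturbations of martingale plans\<close>

lemma nn_integral_eq_ennreal_integral:
  fixes f :: "'a \<Rightarrow> real"
  assumes "finite_measure M" "f \<in> borel_measurable M" "\<And>x. 0 \<le> f x" "\<And>x. f x \<le> K"
  shows "(\<integral>\<^sup>+ x. ennreal (f x) \<partial>M) = ennreal (\<integral>x. f x \<partial>M)" and "integrable M f"
proof -
  show "integrable M f"
    by (rule finite_measure.integrable_const_bound[OF assms(1), of _ K]) (use assms in auto)
  then show "(\<integral>\<^sup>+ x. ennreal (f x) \<partial>M) = ennreal (\<integral>x. f x \<partial>M)"
    using assms by (intro nn_integral_eq_integral) auto
qed

text \<open>
  The competitor removes the part \<open>\<rho> \<pi>\<close> of the plan and adds \<open>A (\<mu> \<otimes> N)\<close>, where \<open>N\<close> is the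
  second marginal of the removed part; the hypotheses say that both parts have the same marginals
  and, over every \<open>x\<close>, the same mass and barycentre.
\<close>
lemma optimal_martingale_plan_perturbation:
  fixes \<rho> A :: "real \<times> real \<Rightarrow> real" and c :: "real \<Rightarrow> real \<Rightarrow> real"
  assumes opt: "optimal_martingale_plan c \<mu> \<nu> \<pi>"
    and c: "integrable \<pi> (\<lambda>(x, y). c x y)"
    and d: "disintegration \<pi> \<mu> \<kappa>"
    and mart: "AE x in \<mu>. integrable (\<kappa> x) (\<lambda>y. y) \<and> (\<integral>y. y \<partial>\<kappa> x) = x"
    and \<mu>: "prob_space \<mu>" "sets \<mu> = sets borel"
    and \<rho>: "\<rho> \<in> borel_measurable borel" "\<And>z. 0 \<le> \<rho> z" "\<And>z. \<rho> z \<le> 1"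
    and A: "A \<in> borel_measurable borel" "\<And>z. 0 \<le> A z" "\<And>z. A z \<le> L"
    and supp: "\<And>x y. \<rho> (x, y) \<noteq> 0 \<Longrightarrow> \<bar>y\<bar> \<le> K" "\<And>x y. A (x, y) \<noteq> 0 \<Longrightarrow> \<bar>y\<bar> \<le> K"
    and N: "N = distr (density \<pi> \<rho>) borel snd"
    and mass: "\<And>x. (\<integral>y. A (x, y) \<partial>N) = (\<integral>y. \<rho> (x, y) \<partial>\<kappa> x)"
    and mean: "\<And>x. (\<integral>y. A (x, y) * y \<partial>N) = (\<integral>y. \<rho> (x, y) * y \<partial>\<kappa> x)"
    and marg: "AE y in N. (\<integral>x. A (x, y) \<partial>\<mu>) = 1"
    and cA: "integrable (\<mu> \<Otimes>\<^sub>M N) (\<lambda>(x, y). A (x, y) * c x y)"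
  shows "(\<integral>(x, y). \<rho> (x, y) * c x y \<partial>\<pi>) \<le> (\<integral>(x, y). A (x, y) * c x y \<partial>(\<mu> \<Otimes>\<^sub>M N))"
proof -
  have \<pi>: "\<pi> \<in> martingale_plans \<mu> \<nu>" and
    opt': "\<And>\<pi>'. \<pi>' \<in> martingale_plans \<mu> \<nu> \<Longrightarrow> transport_cost c \<pi> \<le> transport_cost c \<pi>'"
    using opt by (auto simp: optimal_martingale_plan_def)
  from \<pi> have s\<pi>: "sets \<pi> = sets borel" and snd\<pi>: "distr \<pi> borel snd = \<nu>"
    by (auto simp: martingale_plans_def)
  interpret \<mu>: prob_space \<mu> by fact
  interpret \<kappa>: prob_space "\<kappa> x" for x by (rule disintegrationD[OF d])
  have sN: "sets N = sets borel" by (simp add: N)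
  note sets = s\<pi> \<mu>(2) sN disintegrationD(2)[OF d]
  note [measurable_cong] = sets
  have sp: "space \<pi> = UNIV" "space \<mu> = UNIV" "space N = UNIV" "space (\<kappa> x) = UNIV" for x
    using sets[THEN sets_eq_imp_space_eq] by simp_all
  have [measurable]: "\<rho> \<in> borel_measurable (borel \<Otimes>\<^sub>M borel)" "A \<in> borel_measurable (borel \<Otimes>\<^sub>M borel)"
    using \<rho> A by (simp_all add: borel_prod)
  have \<rho>\<pi> [measurable]: "\<rho> \<in> borel_measurable \<pi>"
    using \<rho>(1) unfolding measurable_cong_sets[OF s\<pi> refl] .
  have snd [measurable]: "snd \<in> \<pi> \<rightarrow>\<^sub>M (borel :: real measure)"
    unfolding measurable_cong_sets[OF s\<pi> refl] by (simp add: borel_prod[symmetric])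
  have cm: "(\<lambda>(x, y). c x y) \<in> borel_measurable \<pi>"
    using c by (rule borel_measurable_integrable)
  then have [measurable]: "(\<lambda>(x, y). c x y) \<in> borel_measurable (borel \<Otimes>\<^sub>M borel)"
    unfolding measurable_cong_sets[OF s\<pi> refl] by (simp add: borel_prod)
  have emN: "emeasure N E = (\<integral>\<^sup>+ z. ennreal (\<rho> z) * indicator E (snd z) \<partial>\<pi>)" if [measurable]: "E \<in> sets borel" for E
  proof -
    have [measurable]: "snd -` E \<inter> space \<pi> \<in> sets \<pi>"
      by (rule measurable_sets[OF snd that])
    have "emeasure N E = emeasure (density \<pi> \<rho>) (snd -` E \<inter> space \<pi>)"
      unfolding N by (subst emeasure_distr) simp_all
    also have "\<dots> = (\<integral>\<^sup>+ z. ennreal (\<rho> z) * indicator (snd -` E \<inter> space \<pi>) z \<partial>\<pi>)"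
      by (rule emeasure_density) simp_all
    also have "\<dots> = (\<integral>\<^sup>+ z. ennreal (\<rho> z) * indicator E (snd z) \<partial>\<pi>)"
      by (rule nn_integral_cong) (auto simp: indicator_def)
    finally show ?thesis .
  qed
  interpret \<pi>: prob_space \<pi> by (rule prob_space_disintegration[OF d s\<pi> \<mu>])
  have "emeasure N UNIV \<le> (\<integral>\<^sup>+ z. 1 \<partial>\<pi>)"
    by (subst emN) (rule nn_integral_mono | simp add: ennreal_le_1 \<rho>)+
  then have "emeasure N (space N) \<noteq> \<infinity>"
    using \<pi>.emeasure_space_1 by (auto simp: sp top_unique)
  then interpret N: finite_measure N by (rule finite_measureI)
  interpret P: pair_sigma_finite \<mu> N ..
  have sP: "sets (\<mu> \<Otimes>\<^sub>M N) = sets borel"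
    using sets_pair_measure_cong[OF \<mu>(2) sN] unfolding borel_prod .
  have [measurable]: "snd \<in> \<mu> \<Otimes>\<^sub>M N \<rightarrow>\<^sub>M (borel :: real measure)"
    unfolding measurable_cong_sets[OF sP refl] by (simp add: borel_prod[symmetric])

  \<comment> \<open>The competitor and its disintegration\<close>
  define \<pi>' where "\<pi>' = add_measure (density \<pi> (\<lambda>z. 1 - \<rho> z)) (density (\<mu> \<Otimes>\<^sub>M N) A)"
  \<comment> \<open>The added part has a density with respect to a product measure, so its fibres
    are densities of the one measure \<open>N\<close> and no choice of kernel is involved.\<close>
  define \<kappa>' where
    "\<kappa>' x = add_measure (density (\<kappa> x) (\<lambda>y. 1 - \<rho> (x, y))) (density N (\<lambda>y. A (x, y)))" for x
  have s\<pi>': "sets \<pi>' = sets borel" by (simp add: \<pi>'_def s\<pi>)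
  have s\<kappa>': "sets (\<kappa>' x) = sets borel" for x by (simp add: \<kappa>'_def sets)
  have nn\<pi>': "(\<integral>\<^sup>+ z. f z \<partial>\<pi>') =
      (\<integral>\<^sup>+ z. ennreal (1 - \<rho> z) * f z \<partial>\<pi>) + (\<integral>\<^sup>+ z. ennreal (A z) * f z \<partial>(\<mu> \<Otimes>\<^sub>M N))"
    if [measurable]: "f \<in> borel_measurable borel" for f :: "real \<times> real \<Rightarrow> ennreal"
  proof -
    have [measurable]: "f \<in> borel_measurable \<pi>" "f \<in> borel_measurable (\<mu> \<Otimes>\<^sub>M N)"
      using that by (simp_all add: s\<pi> sP cong: measurable_cong_sets)
    show ?thesis
      unfolding \<pi>'_def by (subst nn_integral_add_measure) (simp_all add: s\<pi> sP nn_integral_density)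
  qed
  have nn\<kappa>': "(\<integral>\<^sup>+ y. f y \<partial>\<kappa>' x) =
      (\<integral>\<^sup>+ y. ennreal (1 - \<rho> (x, y)) * f y \<partial>\<kappa> x) + (\<integral>\<^sup>+ y. ennreal (A (x, y)) * f y \<partial>N)"
    if [measurable]: "f \<in> borel_measurable borel" for f x
    unfolding \<kappa>'_def by (subst nn_integral_add_measure) (simp_all add: sets nn_integral_density)
  have i\<rho>: "integrable (\<kappa> x) (\<lambda>y. \<rho> (x, y))" for x
    by (rule \<kappa>.integrable_const_bound[of _ 1]) (use \<rho> in auto)
  \<comment> \<open>Removed and added mass cancel by \<open>mass\<close>. This is required for every
    x, since a kernel into \<open>prob_algebra\<close> admits no exceptional set.\<close>
  have p\<kappa>': "prob_space (\<kappa>' x)" for x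
  proof (rule prob_spaceI)
    have "(\<integral>\<^sup>+ y. ennreal (1 - \<rho> (x, y)) \<partial>\<kappa> x) = ennreal (1 - (\<integral>y. \<rho> (x, y) \<partial>\<kappa> x))"
      by (subst nn_integral_eq_ennreal_integral[where K = 1])
        (use i\<rho> \<rho> \<kappa>.prob_space in \<open>auto intro: \<kappa>.finite_measure_axioms\<close>)
    moreover have "(\<integral>\<^sup>+ y. ennreal (A (x, y)) \<partial>N) = ennreal (\<integral>y. \<rho> (x, y) \<partial>\<kappa> x)"
      by (subst nn_integral_eq_ennreal_integral[where K = L])
        (use A mass in \<open>auto intro: N.finite_measure_axioms\<close>)
    moreover have "(\<integral>y. \<rho> (x, y) \<partial>\<kappa> x) \<le> (\<integral>y. 1 \<partial>\<kappa> x)"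
      using i\<rho> \<rho> by (intro integral_mono) auto
    ultimately show "emeasure (\<kappa>' x) (space (\<kappa>' x)) = 1"
      using nn\<kappa>'[of "\<lambda>_. 1" x] \<rho> \<kappa>.prob_space
      by (simp add: ennreal_plus[symmetric] del: ennreal_plus)
  qed
  have d': "disintegration \<pi>' \<mu> \<kappa>'"
    unfolding disintegration_def
  proof (intro conjI ballI)
    have "(\<lambda>x. emeasure (\<kappa>' x) E) \<in> borel_measurable borel" if [measurable]: "E \<in> sets borel" for E
    proof -
      have "(\<lambda>x. \<integral>\<^sup>+ y. ennreal (1 - \<rho> (x, y)) * indicator E y \<partial>\<kappa> x) \<in> borel_measurable borel"
        using measurable_kernel_nn_integral[OF d, of "\<lambda>z. ennreal (1 - \<rho> z) * indicator E (snd z)"]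
        by (simp add: borel_prod[symmetric])
      moreover have "(\<lambda>x. \<integral>\<^sup>+ y. ennreal (A (x, y)) * indicator E y \<partial>N) \<in> borel_measurable borel"
        by measurable
      ultimately show ?thesis
        using nn\<kappa>'[of "indicator E"] s\<kappa>' that by simp
    qed
    then show "\<kappa>' \<in> borel \<rightarrow>\<^sub>M prob_algebra borel"
      using p\<kappa>' s\<kappa>'
      by (intro measurable_prob_algebraI measurable_subprob_algebra)
        (auto intro: prob_space_imp_subprob_space)
    fix S :: "(real \<times> real) set" assume [measurable]: "S \<in> sets borel"
    then have [measurable]: "S \<in> sets (borel \<Otimes>\<^sub>M borel)" unfolding borel_prod .
    have S: "{y. (x, y) \<in> S} \<in> sets borel" for x
      by measurable
    have ind: "indicator {y. (x, y) \<in> S} y = (indicator S (x, y) :: ennreal)" for x y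
      by (simp add: indicator_def)
    have "emeasure \<pi>' S = (\<integral>\<^sup>+ z. indicator S z \<partial>\<pi>')"
      using s\<pi>' by simp
    also have "\<dots> = (\<integral>\<^sup>+ z. ennreal (1 - \<rho> z) * indicator S z \<partial>\<pi>) +
        (\<integral>\<^sup>+ z. ennreal (A z) * indicator S z \<partial>(\<mu> \<Otimes>\<^sub>M N))"
      by (rule nn\<pi>') simp
    also have "(\<integral>\<^sup>+ z. ennreal (1 - \<rho> z) * indicator S z \<partial>\<pi>) =
        (\<integral>\<^sup>+ x. \<integral>\<^sup>+ y. ennreal (1 - \<rho> (x, y)) * indicator S (x, y) \<partial>\<kappa> x \<partial>\<mu>)"
      by (rule nn_integral_disintegration[OF d s\<pi> \<mu>(2)]) (simp add: borel_prod[symmetric])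
    also have "(\<integral>\<^sup>+ z. ennreal (A z) * indicator S z \<partial>(\<mu> \<Otimes>\<^sub>M N)) =
        (\<integral>\<^sup>+ x. \<integral>\<^sup>+ y. ennreal (A (x, y)) * indicator S (x, y) \<partial>N \<partial>\<mu>)"
      by (rule N.nn_integral_fst[symmetric]) measurable
    also have "(\<integral>\<^sup>+ x. \<integral>\<^sup>+ y. ennreal (1 - \<rho> (x, y)) * indicator S (x, y) \<partial>\<kappa> x \<partial>\<mu>) + \<dots> =
        (\<integral>\<^sup>+ x. (\<integral>\<^sup>+ y. ennreal (1 - \<rho> (x, y)) * indicator S (x, y) \<partial>\<kappa> x) +
          (\<integral>\<^sup>+ y. ennreal (A (x, y)) * indicator S (x, y) \<partial>N) \<partial>\<mu>)"
    proof (rule nn_integral_add[symmetric])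
      show "(\<lambda>x. \<integral>\<^sup>+ y. ennreal (1 - \<rho> (x, y)) * indicator S (x, y) \<partial>\<kappa> x) \<in> borel_measurable \<mu>"
        using measurable_kernel_nn_integral[OF d, of "\<lambda>z. ennreal (1 - \<rho> z) * indicator S z"]
        by (simp add: borel_prod[symmetric] cong: measurable_cong_sets)
    qed measurable
    also have "\<dots> = (\<integral>\<^sup>+ x. emeasure (\<kappa>' x) {y. (x, y) \<in> S} \<partial>\<mu>)"
    proof (rule nn_integral_cong)
      fix x
      have "emeasure (\<kappa>' x) {y. (x, y) \<in> S} = (\<integral>\<^sup>+ y. indicator {y. (x, y) \<in> S} y \<partial>\<kappa>' x)"
        using s\<kappa>' S by simp
      also have "\<dots> = (\<integral>\<^sup>+ y. ennreal (1 - \<rho> (x, y)) * indicator S (x, y) \<partial>\<kappa> x) +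
          (\<integral>\<^sup>+ y. ennreal (A (x, y)) * indicator S (x, y) \<partial>N)"
        using S by (subst nn\<kappa>') (simp_all add: ind)
      finally show "(\<integral>\<^sup>+ y. ennreal (1 - \<rho> (x, y)) * indicator S (x, y) \<partial>\<kappa> x) +
          (\<integral>\<^sup>+ y. ennreal (A (x, y)) * indicator S (x, y) \<partial>N) = emeasure (\<kappa>' x) {y. (x, y) \<in> S}"
        by simp
    qed
    finally show "emeasure \<pi>' S = (\<integral>\<^sup>+ x. emeasure (\<kappa>' x) {y. (x, y) \<in> S} \<partial>\<mu>)" .
  qed

  \<comment> \<open>Marginals and martingale property of the competitor\<close>
  have fst': "distr \<pi>' borel fst = \<mu>"
  proof (rule measure_eqI)
    fix E :: "real set" assume "E \<in> sets (distr \<pi>' borel fst)"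
    then have [measurable]: "E \<in> sets borel" by simp
    have vim: "fst -` E \<inter> space \<pi>' = E \<times> UNIV"
      using sets_eq_imp_space_eq[OF s\<pi>'] by auto
    have m: "fst \<in> \<pi>' \<rightarrow>\<^sub>M (borel :: real measure)"
      unfolding measurable_cong_sets[OF s\<pi>' refl] by (simp add: borel_prod[symmetric])
    have "emeasure (distr \<pi>' borel fst) E = emeasure \<pi>' (E \<times> UNIV)"
      by (simp add: emeasure_distr m vim)
    also have "\<dots> = (\<integral>\<^sup>+ x. emeasure (\<kappa>' x) {y. (x, y) \<in> E \<times> UNIV} \<partial>\<mu>)"
      using d' by (simp add: disintegration_def borel_prod[symmetric])
    also have "\<dots> = (\<integral>\<^sup>+ x. indicator E x \<partial>\<mu>)"
    proof (rule nn_integral_cong)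
      fix x
      have "emeasure (\<kappa>' x) UNIV = 1"
        using prob_space.emeasure_space_1[OF p\<kappa>'] sets_eq_imp_space_eq[OF s\<kappa>'] by simp
      then show "emeasure (\<kappa>' x) {y. (x, y) \<in> E \<times> UNIV} = indicator E x"
        by (auto simp: indicator_def)
    qed
    finally show "emeasure (distr \<pi>' borel fst) E = emeasure \<mu> E" by simp
  qed (simp add: \<mu>)
  \<comment> \<open>Hence the added part has second marginal \<open>N\<close>, which by
    \<open>emN\<close> is exactly what the removal took from \<nu>.\<close>
  have A1: "AE y in N. (\<integral>\<^sup>+ x. ennreal (A (x, y)) \<partial>\<mu>) = 1"
    using marg
  proof eventually_elim
    case (elim y)
    then show ?case
      by (subst nn_integral_eq_ennreal_integral[where K = L])
        (use A in \<open>auto intro: \<mu>.finite_measure_axioms\<close>)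
  qed
  have snd': "distr \<pi>' borel snd = \<nu>"
  proof (rule measure_eqI)
    show "sets (distr \<pi>' borel snd) = sets \<nu>" using snd\<pi> by auto
    fix E :: "real set" assume "E \<in> sets (distr \<pi>' borel snd)"
    then have [measurable]: "E \<in> sets borel" by simp
    have m: "snd \<in> \<pi>' \<rightarrow>\<^sub>M (borel :: real measure)"
      unfolding measurable_cong_sets[OF s\<pi>' refl] by (simp add: borel_prod[symmetric])
    have "emeasure (distr \<pi>' borel snd) E = (\<integral>\<^sup>+ y. indicator E y \<partial>distr \<pi>' borel snd)"
      by simp
    also have "\<dots> = (\<integral>\<^sup>+ z. indicator E (snd z) \<partial>\<pi>')"
      by (rule nn_integral_distr) (use m in auto)
    also have "\<dots> = (\<integral>\<^sup>+ z. ennreal (1 - \<rho> z) * indicator E (snd z) \<partial>\<pi>) +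
        (\<integral>\<^sup>+ z. ennreal (A z) * indicator E (snd z) \<partial>(\<mu> \<Otimes>\<^sub>M N))"
      by (rule nn\<pi>') (simp add: borel_prod[symmetric])
    also have "(\<integral>\<^sup>+ z. ennreal (A z) * indicator E (snd z) \<partial>(\<mu> \<Otimes>\<^sub>M N)) =
        (\<integral>\<^sup>+ y. \<integral>\<^sup>+ x. ennreal (A (x, y)) * indicator E y \<partial>\<mu> \<partial>N)"
      by (subst P.nn_integral_snd[symmetric]) simp_all
    also have "\<dots> = (\<integral>\<^sup>+ y. (\<integral>\<^sup>+ x. ennreal (A (x, y)) \<partial>\<mu>) * indicator E y \<partial>N)"
      by (simp add: nn_integral_multc)
    also have "\<dots> = (\<integral>\<^sup>+ y. indicator E y \<partial>N)"
      by (rule nn_integral_cong_AE) (use A1 in eventually_elim, simp)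
    also have "\<dots> = (\<integral>\<^sup>+ z. ennreal (\<rho> z) * indicator E (snd z) \<partial>\<pi>)"
      using emN[of E] by simp
    also have "(\<integral>\<^sup>+ z. ennreal (1 - \<rho> z) * indicator E (snd z) \<partial>\<pi>) + \<dots> =
        (\<integral>\<^sup>+ z. ennreal (1 - \<rho> z) * indicator E (snd z) + ennreal (\<rho> z) * indicator E (snd z) \<partial>\<pi>)"
      by (rule nn_integral_add[symmetric]) measurable
    also have "\<dots> = (\<integral>\<^sup>+ z. indicator E (snd z) \<partial>\<pi>)"
      using \<rho> by (intro nn_integral_cong)
        (simp add: distrib_right[symmetric] ennreal_plus[symmetric] del: ennreal_plus)
    also have "\<dots> = (\<integral>\<^sup>+ y. indicator E y \<partial>distr \<pi> borel snd)"
      by (rule nn_integral_distr[symmetric]) auto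
    also have "\<dots> = emeasure \<nu> E"
      using snd\<pi> by auto
    finally show "emeasure (distr \<pi>' borel snd) E = emeasure \<nu> E" .
  qed
  \<comment> \<open>The bounded support of \<rho> and \<open>A\<close> in y makes the first moments
    of both parts absolutely convergent, so that \<open>mean\<close> may be added to the barycentre
    identity of \<open>\<kappa> x\<close>.\<close>
  have bd: "\<bar>\<rho> (x, y) * y\<bar> \<le> \<bar>K\<bar>" "\<bar>A (x, y) * y\<bar> \<le> L * \<bar>K\<bar>" for x y
  proof -
    have "\<bar>\<rho> (x, y) * y\<bar> \<le> 1 * \<bar>K\<bar>"
      using supp(1)[of x y] \<rho>(2,3)[of "(x, y)"] unfolding abs_mult
      by (cases "\<rho> (x, y) = 0") (auto intro: order_trans[OF mult_left_le_one_le])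
    then show "\<bar>\<rho> (x, y) * y\<bar> \<le> \<bar>K\<bar>" by simp
    have "0 \<le> L" using A(2,3)[of "(x, y)"] by linarith
    then show "\<bar>A (x, y) * y\<bar> \<le> L * \<bar>K\<bar>"
      using supp(2)[of x y] A(2,3)[of "(x, y)"] unfolding abs_mult
      by (cases "A (x, y) = 0") (auto intro!: mult_mono)
  qed
  have mart': "AE x in \<mu>. integrable (\<kappa>' x) (\<lambda>y. y) \<and> (\<integral>y. y \<partial>\<kappa>' x) = x"
    using mart
  proof eventually_elim
    case (elim x)
    have i1: "integrable (\<kappa> x) (\<lambda>y. \<rho> (x, y) * y)"
      by (rule \<kappa>.integrable_const_bound[of _ "\<bar>K\<bar>"]) (use bd in auto)
    have i2: "integrable N (\<lambda>y. A (x, y) * y)"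
      by (rule N.integrable_const_bound[of _ "L * \<bar>K\<bar>"]) (use bd in auto)
    have i3: "integrable (\<kappa> x) (\<lambda>y. (1 - \<rho> (x, y)) * y)"
      using i1 elim by (simp add: left_diff_distrib)
    have a: "integrable (density (\<kappa> x) (\<lambda>y. 1 - \<rho> (x, y))) (\<lambda>y. y)"
      using i3 \<rho> by (subst integrable_real_density) auto
    have b: "integrable (density N (\<lambda>y. A (x, y))) (\<lambda>y. y)"
      using i2 A by (subst integrable_real_density) auto
    have s: "sets (density N (\<lambda>y. A (x, y))) = sets (density (\<kappa> x) (\<lambda>y. 1 - \<rho> (x, y)))"
      by (simp add: sets)
    have "(\<integral>y. y \<partial>\<kappa>' x) = (\<integral>y. (1 - \<rho> (x, y)) * y \<partial>\<kappa> x) + (\<integral>y. A (x, y) * y \<partial>N)"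
      unfolding \<kappa>'_def integrable_add_measure(2)[OF s a b] using \<rho> A
      by (subst (1 2) integral_real_density) auto
    also have "\<dots> = x"
      using i1 elim mean[of x] by (simp add: left_diff_distrib)
    finally show ?case
      unfolding \<kappa>'_def using integrable_add_measure(1)[OF s a b] by simp
  qed
  have \<pi>'_mart: "\<pi>' \<in> martingale_plans \<mu> \<nu>"
    using s\<pi>' fst' snd' d' mart' by (auto simp: martingale_plans_def)

  \<comment> \<open>Comparison of costs\<close>
  have i\<rho>c: "integrable \<pi> (\<lambda>z. \<rho> z * (case z of (x, y) \<Rightarrow> c x y))"
    using c \<rho> by (rule_tac Bochner_Integration.integrable_bound[OF c])
      (auto simp: abs_mult mult_left_le_one_le intro!: borel_measurable_times cm)
  have i1: "integrable \<pi> (\<lambda>z. (1 - \<rho> z) * (case z of (x, y) \<Rightarrow> c x y))"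
    using Bochner_Integration.integrable_diff[OF c i\<rho>c] by (simp add: left_diff_distrib)
  have i2: "integrable (\<mu> \<Otimes>\<^sub>M N) (\<lambda>z. A z * (case z of (x, y) \<Rightarrow> c x y))"
    using cA by (simp add: split_beta')
  have A\<mu>N: "A \<in> borel_measurable (\<mu> \<Otimes>\<^sub>M N)" "(\<lambda>(x, y). c x y) \<in> borel_measurable (\<mu> \<Otimes>\<^sub>M N)"
    by measurable
  have a: "integrable (density \<pi> (\<lambda>z. 1 - \<rho> z)) (\<lambda>(x, y). c x y)"
    using i1 \<rho> cm by (subst integrable_real_density) auto
  have b: "integrable (density (\<mu> \<Otimes>\<^sub>M N) A) (\<lambda>(x, y). c x y)"
    using i2 A A\<mu>N by (subst integrable_real_density) auto
  have s: "sets (density (\<mu> \<Otimes>\<^sub>M N) A) = sets (density \<pi> (\<lambda>z. 1 - \<rho> z))"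
    by (simp add: sP s\<pi>)
  note ab = integrable_add_measure[OF s a b, folded \<pi>'_def]
  have "(\<integral>(x, y). c x y \<partial>\<pi>') = (\<integral>z. (1 - \<rho> z) * (case z of (x, y) \<Rightarrow> c x y) \<partial>\<pi>) +
      (\<integral>z. A z * (case z of (x, y) \<Rightarrow> c x y) \<partial>(\<mu> \<Otimes>\<^sub>M N))"
    unfolding ab(2) using \<rho> A cm A\<mu>N by (subst (1 2) integral_real_density) auto
  moreover have "(\<integral>z. (1 - \<rho> z) * (case z of (x, y) \<Rightarrow> c x y) \<partial>\<pi>) =
      (\<integral>(x, y). c x y \<partial>\<pi>) - (\<integral>z. \<rho> z * (case z of (x, y) \<Rightarrow> c x y) \<partial>\<pi>)"
    using c i\<rho>c by (simp add: left_diff_distrib)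
  \<comment> \<open>Both plans have integrable cost, so the optimality inequality between extended
    integrals becomes one between real integrals, from which the unremoved part cancels.\<close>
  moreover have "(\<integral>(x, y). c x y \<partial>\<pi>) \<le> (\<integral>(x, y). c x y \<partial>\<pi>')"
    using opt'[OF \<pi>'_mart] unfolding transport_cost_def
    by (simp add: ext_integral_eq_integral[OF c] ext_integral_eq_integral[OF ab(1)])
  ultimately show ?thesis by (simp add: split_beta')
qed

lemma integral_pos_of_pos_on:
  fixes u :: "'a \<Rightarrow> real"
  assumes "integrable M u" "\<And>x. 0 \<le> u x" "\<And>x. x \<in> S \<Longrightarrow> 0 < u x" "S \<in> sets M" "emeasure M S \<noteq> 0"
  shows "0 < (\<integral>x. u x \<partial>M)"
proof (rule ccontr)
  assume "\<not> 0 < (\<integral>x. u x \<partial>M)"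
  moreover have "0 \<le> (\<integral>x. u x \<partial>M)"
    using assms by simp
  ultimately have "(\<integral>x. u x \<partial>M) = 0"
    by linarith
  then have "AE x in M. u x = 0"
    using assms by (subst (asm) integral_nonneg_eq_0_iff_AE) auto
  then have "AE x in M. x \<notin> S"
    by eventually_elim (use assms(3) in force)
  with assms(4,5) show False
    using AE_iff_null_sets[of S M] by (auto simp: null_sets_def)
qed

text \<open>Supplies the data for \<open>optimal_martingale_plan_perturbation\<close>. The order of
  the intervals is essential: every r between \<open>z1\<close> and \<open>z2\<close> has
  \<open>I0\<close> strictly to its left and \<open>I2\<close> strictly to its right, so mass on the
  outer intervals can be balanced about it. \<rho> has to be chosen first, since \<open>N\<close>,
  and through it \<open>A\<close>, is defined from \<rho>.\<close>

lemma swap_perturbation: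
  assumes d: "disintegration \<pi> \<mu> \<kappa>" and s\<pi>: "sets \<pi> = sets borel"
    and \<mu>: "prob_space \<mu>" "sets \<mu> = sets borel"
    and CD [measurable]: "C \<in> sets borel" "D \<in> sets borel" "C \<inter> D = {}"
    and \<mu>CD: "emeasure \<mu> C \<noteq> 0" "emeasure \<mu> D \<noteq> 0"
    and I [measurable]: "I0 \<in> sets borel" "I1 \<in> sets borel" "I2 \<in> sets borel"
    and Isub: "I0 \<subseteq> {-K..<z1}" "I1 \<subseteq> {z1..z2}" "I2 \<subseteq> {z2<..K}"
    and z: "-K \<le> z1" "z1 \<le> z2" "z2 \<le> K"
    and \<kappa>C: "\<And>x. x \<in> C \<Longrightarrow> emeasure (\<kappa> x) I1 \<noteq> 0"
    and \<kappa>D: "\<And>x. x \<in> D \<Longrightarrow> emeasure (\<kappa> x) I0 \<noteq> 0" "\<And>x. x \<in> D \<Longrightarrow> emeasure (\<kappa> x) I2 \<noteq> 0"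
  obtains \<rho> A :: "real \<times> real \<Rightarrow> real" and L :: real and N :: "real measure"
  where "\<rho> \<in> borel_measurable borel" "\<And>z. 0 \<le> \<rho> z" "\<And>z. \<rho> z \<le> 1"
    and "A \<in> borel_measurable borel" "\<And>z. 0 \<le> A z" "\<And>z. A z \<le> L"
    and "\<And>z. \<rho> z \<noteq> 0 \<Longrightarrow> z \<in> C \<times> I1 \<union> D \<times> (I0 \<union> I2)"
    and "\<And>z. A z \<noteq> 0 \<Longrightarrow> z \<in> D \<times> I1 \<union> C \<times> (I0 \<union> I2)"
    and "N = distr (density \<pi> \<rho>) borel snd"
    and "\<And>x. (\<integral>y. A (x, y) \<partial>N) = (\<integral>y. \<rho> (x, y) \<partial>\<kappa> x)"
    and "\<And>x. (\<integral>y. A (x, y) * y \<partial>N) = (\<integral>y. \<rho> (x, y) * y \<partial>\<kappa> x)"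
    and "AE y in N. (\<integral>x. A (x, y) \<partial>\<mu>) = 1"
    and "0 < (\<integral>z. \<rho> z \<partial>\<pi>)"
proof -
  interpret \<mu>: prob_space \<mu> by fact
  interpret \<kappa>: prob_space "\<kappa> x" for x by (rule disintegrationD[OF d])
  note [measurable_cong] = s\<pi> \<mu>(2) disintegrationD(2)[OF d]
  note \<kappa>m [measurable] = disintegrationD(3)[OF d]
  have K0: "0 \<le> K" using z by simp
  define E where "E f x = (\<integral>y. f y \<partial>\<kappa> x)" for f :: "real \<Rightarrow> real" and x
  have Em [measurable]: "E f \<in> borel_measurable borel" if [measurable]: "f \<in> borel_measurable borel" for f
    unfolding E_def by (rule measurable_compose[OF \<kappa>m]) measurable
  have Ei: "integrable (\<kappa> x) f" if "f \<in> borel_measurable borel" "\<And>y. \<bar>f y\<bar> \<le> B"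
    for f :: "real \<Rightarrow> real" and B x
    by (rule \<kappa>.integrable_const_bound[of _ B]) (use that in auto)
  have Emono: "E f x \<le> E g x" if "f \<in> borel_measurable borel" "\<And>y. \<bar>f y\<bar> \<le> B"
    "g \<in> borel_measurable borel" "\<And>y. \<bar>g y\<bar> \<le> B'" "\<And>y. f y \<le> g y" for f g B B' x
    unfolding E_def by (rule integral_mono[OF Ei Ei]) (use that in auto)
  have Econst: "E (\<lambda>_. a) x = a" for a x by (simp add: E_def \<kappa>.prob_space)
  have Ebd: "\<bar>E f x\<bar> \<le> B" if "f \<in> borel_measurable borel" "\<And>y. \<bar>f y\<bar> \<le> B" for f B x
  proof -
    have "f y \<le> B" "-B \<le> f y" for y using that(2)[of y] by auto
    then show ?thesis
      using Emono[of f B "\<lambda>_. B" "\<bar>B\<bar>" x] Emono[of "\<lambda>_. -B" "\<bar>B\<bar>" f B x] that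
      by (auto simp: Econst)
  qed
  have \<mu>i: "integrable \<mu> u" if "u \<in> borel_measurable borel" "\<And>x. \<bar>u x\<bar> \<le> B"
    for u :: "real \<Rightarrow> real" and B
    by (rule \<mu>.integrable_const_bound[of _ B]) (use that in auto)

  define fC fD :: "real \<Rightarrow> real" where "fC = indicator C" and "fD = indicator D"
  define j0 j1 j2 :: "real \<Rightarrow> real" where "j0 = indicator I0" and "j1 = indicator I1" and "j2 = indicator I2"
  have [measurable]: "fC \<in> borel_measurable borel" "fD \<in> borel_measurable borel"
    "j0 \<in> borel_measurable borel" "j1 \<in> borel_measurable borel" "j2 \<in> borel_measurable borel"
    by (simp_all add: fC_def fD_def j0_def j1_def j2_def)
  have j01: "0 \<le> j0 y" "j0 y \<le> 1" "0 \<le> j1 y" "j1 y \<le> 1" "0 \<le> j2 y" "j2 y \<le> 1"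
    "0 \<le> fC x" "fC x \<le> 1" "0 \<le> fD x" "fD x \<le> 1" for x y
    by (simp_all add: fC_def fD_def j0_def j1_def j2_def indicator_def)
  have jabs: "\<bar>j0 y\<bar> \<le> 1" "\<bar>j1 y\<bar> \<le> 1" "\<bar>j2 y\<bar> \<le> 1" "\<bar>fC x\<bar> \<le> 1" "\<bar>fD x\<bar> \<le> 1" for x y
    using j01 by simp_all
  have jj: "j0 y * j1 y = 0" "j0 y * j2 y = 0" "j1 y * j2 y = 0" "j0 y * j0 y = j0 y" "j1 y * j1 y = j1 y"
    "j2 y * j2 y = j2 y" for y
  proof -
    have "y \<in> I0 \<Longrightarrow> y < z1" "y \<in> I1 \<Longrightarrow> z1 \<le> y \<and> y \<le> z2" "y \<in> I2 \<Longrightarrow> z2 < y"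
      using Isub by auto
    then show "j0 y * j1 y = 0" "j0 y * j2 y = 0" "j1 y * j2 y = 0" "j0 y * j0 y = j0 y" "j1 y * j1 y = j1 y"
      "j2 y * j2 y = j2 y"
      using z by (auto simp: j0_def j1_def j2_def indicator_def)
  qed
  have ind1: "x \<in> C \<Longrightarrow> fC x = 1" "x \<in> D \<Longrightarrow> fD x = 1" for x
    by (simp_all add: fC_def fD_def)
  have CD0: "fC x * fD x = 0" for x using CD by (auto simp: fC_def fD_def indicator_def)
  have prod1: "\<bar>u * v\<bar> \<le> B" if "\<bar>u\<bar> \<le> 1" "\<bar>v\<bar> \<le> B" for u v B :: real
    using that mult_mono[of "\<bar>u\<bar>" 1 "\<bar>v\<bar>" B] by (simp add: abs_mult)

  \<comment> \<open>Fibre masses, the barycentre \<open>r\<close>, and moments about it\<close>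
  define m0 m1 m2 where "m0 = E j0" and "m1 = E j1" and "m2 = E j2"
  have [measurable]: "m0 \<in> borel_measurable borel" "m1 \<in> borel_measurable borel" "m2 \<in> borel_measurable borel"
    by (simp_all add: m0_def m1_def m2_def)
  have m01: "0 \<le> m0 x" "m0 x \<le> 1" "0 \<le> m1 x" "m1 x \<le> 1" "0 \<le> m2 x" "m2 x \<le> 1" for x
    using Emono[of "\<lambda>_. 0" 0 j0 1 x] Emono[of "\<lambda>_. 0" 0 j1 1 x] Emono[of "\<lambda>_. 0" 0 j2 1 x]
      Emono[of j0 1 "\<lambda>_. 1" 1 x] Emono[of j1 1 "\<lambda>_. 1" 1 x] Emono[of j2 1 "\<lambda>_. 1" 1 x]
    by (simp_all add: Econst m0_def m1_def m2_def j01 jabs)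
  have mabs: "\<bar>m0 x\<bar> \<le> 1" "\<bar>m1 x\<bar> \<le> 1" "\<bar>m2 x\<bar> \<le> 1" for x
    using m01[of x] by auto
  have m_pos: "x \<in> D \<Longrightarrow> 0 < m0 x" "x \<in> C \<Longrightarrow> 0 < m1 x" "x \<in> D \<Longrightarrow> 0 < m2 x" for x
    unfolding m0_def m1_def m2_def E_def
    by (rule integral_pos_of_pos_on[OF Ei[of _ 1], of _ I0] integral_pos_of_pos_on[OF Ei[of _ 1], of _ I1]
        integral_pos_of_pos_on[OF Ei[of _ 1], of _ I2];
        use \<kappa>C \<kappa>D jabs j01 disintegrationD(2)[OF d] in \<open>simp add: j0_def j1_def j2_def\<close>)+

  define W where "W = (\<integral>x. fC x * m1 x \<partial>\<mu>)"
  have W_pos: "0 < W"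
    unfolding W_def
    by (rule integral_pos_of_pos_on[OF \<mu>i[of _ 1], of _ C])
      (use m_pos m01 j01 jabs mabs \<mu>CD \<mu>(2) ind1 in \<open>auto intro!: mult_le_one\<close>)
  \<comment> \<open>This is the barycentre of the \<pi>-mass in C \<times> I1. The choice makes the
    first moment about \<open>r\<close> vanish when summed over \<open>C\<close>
    (\<open>fCe1\<close>), which later gives both the barycentre of \<open>N\<close> on
    \<open>I1\<close> and the second marginal of \<open>A\<close>.\<close>
  define r where "r = (\<integral>x. fC x * E (\<lambda>y. j1 y * y) x \<partial>\<mu>) / W"
  have yabs: "\<bar>j0 y * y\<bar> \<le> K" "\<bar>j1 y * y\<bar> \<le> K" "\<bar>j2 y * y\<bar> \<le> K" for y
    using Isub z by (auto simp: j0_def j1_def j2_def indicator_def split: if_splits) (fastforce simp: abs_le_iff)+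
  have i_fCm1: "integrable \<mu> (\<lambda>x. fC x * m1 x)"
    by (rule \<mu>i[of _ 1]) (use prod1 jabs mabs in auto)
  have i_fCM1: "integrable \<mu> (\<lambda>x. fC x * E (\<lambda>y. j1 y * y) x)"
    by (rule \<mu>i[of _ K]) (use prod1 jabs Ebd[of "\<lambda>y. j1 y * y" K] yabs in auto)
  have M1_bd: "z1 * m1 x \<le> E (\<lambda>y. j1 y * y) x" "E (\<lambda>y. j1 y * y) x \<le> z2 * m1 x" for x
  proof -
    have *: "E (\<lambda>y. j1 y * a) x = a * m1 x" for a
      by (simp add: E_def m1_def)
    have "E (\<lambda>y. j1 y * z1) x \<le> E (\<lambda>y. j1 y * y) x"
      by (rule Emono[of _ "\<bar>z1\<bar>" _ K])
        (use prod1 jabs yabs Isub in \<open>auto simp: j1_def indicator_def\<close>)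
    moreover have "E (\<lambda>y. j1 y * y) x \<le> E (\<lambda>y. j1 y * z2) x"
      by (rule Emono[of _ K _ "\<bar>z2\<bar>"])
        (use prod1 jabs yabs Isub in \<open>auto simp: j1_def indicator_def\<close>)
    ultimately show "z1 * m1 x \<le> E (\<lambda>y. j1 y * y) x" "E (\<lambda>y. j1 y * y) x \<le> z2 * m1 x"
      unfolding * by auto
  qed
  have r: "z1 \<le> r" "r \<le> z2"
  proof -
    have le: "z1 * (fC x * m1 x) \<le> fC x * E (\<lambda>y. j1 y * y) x"
      "fC x * E (\<lambda>y. j1 y * y) x \<le> z2 * (fC x * m1 x)" for x
      using M1_bd[of x, THEN mult_left_mono, OF j01(7)[of x]] by (simp_all add: mult.left_commute)
    have "z1 * W \<le> (\<integral>x. fC x * E (\<lambda>y. j1 y * y) x \<partial>\<mu>)"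
      unfolding W_def integral_mult_right_zero[symmetric]
      by (rule integral_mono[OF _ i_fCM1])
        (use i_fCm1 le in auto)
    moreover have "(\<integral>x. fC x * E (\<lambda>y. j1 y * y) x \<partial>\<mu>) \<le> z2 * W"
      unfolding W_def integral_mult_right_zero[symmetric]
      by (rule integral_mono[OF i_fCM1])
        (use i_fCm1 le in auto)
    ultimately show "z1 \<le> r" "r \<le> z2"
      using W_pos by (auto simp: r_def field_simps)
  qed
  have rK: "\<bar>r\<bar> \<le> K" using r z by auto

  \<comment> \<open>From here on first moments are taken about \<open>r\<close>: \<open>d0\<close>,
    \<open>d1\<close>, \<open>d2\<close> localise y - r to the three intervals, and
    \<open>e0\<close>, \<open>e1\<close>, \<open>e2\<close> are their fibre integrals.\<close>
  define d0 d1 d2 where "d0 y = j0 y * (y - r)" and "d1 y = j1 y * (y - r)" and "d2 y = j2 y * (y - r)" for y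
  have [measurable]: "d0 \<in> borel_measurable borel" "d1 \<in> borel_measurable borel" "d2 \<in> borel_measurable borel"
    by (simp_all add: d0_def[abs_def] d1_def[abs_def] d2_def[abs_def])
  have dabs: "\<bar>d0 y\<bar> \<le> 2 * K" "\<bar>d1 y\<bar> \<le> 2 * K" "\<bar>d2 y\<bar> \<le> 2 * K" for y
    using yabs[of y] rK K0 by (auto simp: d0_def d1_def d2_def j0_def j1_def j2_def indicator_def)
  define e0 e1 e2 where "e0 = E d0" and "e1 = E d1" and "e2 = E d2"
  have [measurable]: "e0 \<in> borel_measurable borel" "e1 \<in> borel_measurable borel" "e2 \<in> borel_measurable borel"
    by (simp_all add: e0_def e1_def e2_def)
  have eabs: "\<bar>e0 x\<bar> \<le> 2 * K" "\<bar>e1 x\<bar> \<le> 2 * K" "\<bar>e2 x\<bar> \<le> 2 * K" for x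
    using dabs by (auto simp: e0_def e1_def e2_def intro!: Ebd)
  have d_sgn: "d0 y \<le> 0" "0 \<le> d2 y" "y \<in> I0 \<Longrightarrow> d0 y < 0" "y \<in> I2 \<Longrightarrow> 0 < d2 y" for y
    using Isub r by (auto simp: d0_def d2_def j0_def j2_def indicator_def)
  have e_sgn: "e0 x \<le> 0" "0 \<le> e2 x" for x
    using Emono[of d0 "2 * K" "\<lambda>_. 0" 0 x] Emono[of "\<lambda>_. 0" 0 d2 "2 * K" x] d_sgn dabs
    by (simp_all add: Econst e0_def e2_def)
  have e2_pos: "0 < e2 x" if "x \<in> D" for x
    unfolding e2_def E_def
    by (rule integral_pos_of_pos_on[OF Ei[of _ "2 * K"], of _ I2])
      (use \<kappa>D that d_sgn dabs disintegrationD(2)[OF d] in simp_all)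
  have "0 < (\<integral>y. - d0 y \<partial>\<kappa> x)" if "x \<in> D" for x
    by (rule integral_pos_of_pos_on[OF Ei[of _ "2 * K"], of _ I0])
      (use \<kappa>D that d_sgn dabs disintegrationD(2)[OF d] in simp_all)
  then have e0_neg: "e0 x < 0" if "x \<in> D" for x
    using that by (simp add: e0_def E_def)
  have e1_bd: "(z1 - r) * m1 x \<le> e1 x" "e1 x \<le> (z2 - r) * m1 x"
    and e1_eq: "e1 x = E (\<lambda>y. j1 y * y) x - r * m1 x" for x
  proof -
    have i: "integrable (\<kappa> x) (\<lambda>y. j1 y * y)" "integrable (\<kappa> x) (\<lambda>y. j1 y * r)"
      by (rule Ei[of _ K]; use yabs in simp) (rule Ei[of _ "\<bar>r\<bar>"]; use prod1 jabs in simp)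
    show "e1 x = E (\<lambda>y. j1 y * y) x - r * m1 x"
      using i by (simp add: e1_def m1_def E_def d1_def right_diff_distrib)
    then show "(z1 - r) * m1 x \<le> e1 x" "e1 x \<le> (z2 - r) * m1 x"
      using M1_bd[of x] by (simp_all add: left_diff_distrib)
  qed
  have fCe1: "(\<integral>x. fC x * e1 x \<partial>\<mu>) = 0"
  proof -
    have "(\<integral>x. fC x * e1 x \<partial>\<mu>) = (\<integral>x. fC x * E (\<lambda>y. j1 y * y) x - r * (fC x * m1 x) \<partial>\<mu>)"
      by (simp add: e1_eq right_diff_distrib mult_ac)
    also have "\<dots> = (\<integral>x. fC x * E (\<lambda>y. j1 y * y) x \<partial>\<mu>) - r * W"
      using i_fCm1 i_fCM1 by (simp add: W_def)
    finally show ?thesis using W_pos by (simp add: r_def)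
  qed

  \<comment> \<open>The removed part\<close>
  define g where "g x = e2 x * m0 x - e0 x * m2 x" for x
  have [measurable]: "g \<in> borel_measurable borel" by (simp add: g_def[abs_def])
  have g: "0 \<le> g x" "\<bar>g x\<bar> \<le> 4 * K" "x \<in> D \<Longrightarrow> 0 < g x" for x
  proof -
    have "0 \<le> e2 x * m0 x" "0 \<le> - (e0 x * m2 x)"
      using e_sgn[of x] m01[of x] by (simp_all add: mult_nonpos_nonneg)
    moreover have "\<bar>m0 x * e2 x\<bar> \<le> 2 * K" "\<bar>m2 x * e0 x\<bar> \<le> 2 * K"
      using prod1 mabs eabs by blast+
    ultimately show "0 \<le> g x" "\<bar>g x\<bar> \<le> 4 * K" by (auto simp: g_def mult.commute)
    assume "x \<in> D"
    then have "0 < e2 x * m0 x" using e2_pos m_pos by simp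
    with \<open>0 \<le> - (e0 x * m2 x)\<close> show "0 < g x" by (simp add: g_def)
  qed
  define G where "G = (\<integral>x. fD x * g x \<partial>\<mu>)"
  have i_fDg: "integrable \<mu> (\<lambda>x. fD x * g x)"
    by (rule \<mu>i[of _ "4 * K"]) (use prod1 jabs g in auto)
  have G_pos: "0 < G"
    unfolding G_def
    by (rule integral_pos_of_pos_on[OF i_fDg, of D]) (use g j01 \<mu>CD \<mu>(2) ind1 in auto)
  \<comment> \<open>The denominator dominates both \<open>G\<close> and \<open>2 * K * W\<close>.
    This gives \<alpha> \<le> 1 on \<open>C\<close> and, as the weights \<open>e2 x\<close> and
    \<open>- e0 x\<close> are at most \<open>2 * K\<close>, a density of at most 1 on
    \<open>D\<close>; together \<rho> \<le> 1.\<close>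
  define t where "t = 1 / (1 + G + 2 * K * W)"
  define \<alpha> \<beta> where "\<alpha> = t * G" and "\<beta> = t * W"
  have den: "0 < 1 + G + 2 * K * W" using G_pos W_pos K0 by (simp add: add_pos_nonneg)
  have \<alpha>: "0 < \<alpha>" "\<alpha> \<le> 1" and \<beta>: "0 < \<beta>" "\<beta> * (2 * K) \<le> 1" and \<alpha>\<beta>: "\<alpha> * W = \<beta> * G"
    using den G_pos W_pos K0 by (simp_all add: \<alpha>_def \<beta>_def t_def field_simps)

  text \<open>
    The weights \<open>e2 x\<close> and \<open>- e0 x\<close> give the mass removed over \<open>x \<in> D\<close> the barycentre \<open>r\<close>,
    which is also the barycentre of the total mass removed from \<open>I1\<close>. The choice of
    \<open>\<alpha>\<close> and \<open>\<beta>\<close> makes the masses removed over \<open>C\<close> and over \<open>D\<close> equal.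
  \<close>
  define \<rho> where "\<rho> = (\<lambda>(x, y). \<alpha> * (fC x * j1 y) + \<beta> * (fD x * (e2 x * j0 y - e0 x * j2 y)))"
  have [measurable]: "\<rho> \<in> borel_measurable (borel \<Otimes>\<^sub>M borel)" unfolding \<rho>_def by measurable
  have \<rho>m: "\<rho> \<in> borel_measurable borel" using \<open>\<rho> \<in> borel_measurable (borel \<Otimes>\<^sub>M borel)\<close> by (simp add: borel_prod)
  have \<rho>0: "0 \<le> \<rho> z" for z
    using j01 e_sgn \<alpha> \<beta> by (auto simp: \<rho>_def split_beta' intro!: add_nonneg_nonneg mult_nonneg_nonneg)
      (smt (verit) mult_nonneg_nonneg mult_nonpos_nonneg)
  have \<rho>1: "\<rho> z \<le> 1" for z
  proof -
    obtain x y where z: "z = (x, y)" by force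
    have "\<beta> * e2 x \<le> \<beta> * (2 * K)" "\<beta> * - e0 x \<le> \<beta> * (2 * K)"
      using \<beta> eabs[of x] by (simp_all only: abs_le_iff mult_left_mono less_imp_le)
    then have "\<beta> * e2 x \<le> 1" "\<beta> * - e0 x \<le> 1"
      using \<beta>(2) by linarith+
    then show ?thesis
      using jj[of y] \<alpha> CD0[of x]
      by (auto simp: z \<rho>_def fC_def fD_def j0_def j1_def j2_def indicator_def algebra_simps split: if_splits)
  qed
  have \<rho>s: "z \<in> C \<times> I1 \<union> D \<times> (I0 \<union> I2)" if "\<rho> z \<noteq> 0" for z
    using that by (cases z) (auto simp: \<rho>_def fC_def fD_def j0_def j1_def j2_def indicator_def split: if_splits)

  \<comment> \<open>The measure \<open>N\<close> and its moments on the three intervals\<close>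
  define N where "N = distr (density \<pi> \<rho>) borel snd"
  \<comment> \<open>Only the products of f with the indicators have to be bounded, so that the
    formula also covers the unbounded y - r.\<close>
  have E\<rho>: "E (\<lambda>y. \<rho> (x, y) * f y) x =
      \<alpha> * (fC x * E (\<lambda>y. j1 y * f y) x) + \<beta> * (fD x * (e2 x * E (\<lambda>y. j0 y * f y) x - e0 x * E (\<lambda>y. j2 y * f y) x))"
    if [measurable]: "f \<in> borel_measurable borel"
      and b: "\<And>y. \<bar>j0 y * f y\<bar> \<le> B" "\<And>y. \<bar>j1 y * f y\<bar> \<le> B" "\<And>y. \<bar>j2 y * f y\<bar> \<le> B" for f B x
  proof -
    have i: "integrable (\<kappa> x) (\<lambda>y. j0 y * f y)" "integrable (\<kappa> x) (\<lambda>y. j1 y * f y)" "integrable (\<kappa> x) (\<lambda>y. j2 y * f y)"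
      by (rule Ei[of _ B]; use b in simp)+
    have "E (\<lambda>y. \<rho> (x, y) * f y) x = (\<integral>y. \<alpha> * (fC x * (j1 y * f y)) +
        \<beta> * (fD x * (e2 x * (j0 y * f y) - e0 x * (j2 y * f y))) \<partial>\<kappa> x)"
      unfolding E_def \<rho>_def by (rule Bochner_Integration.integral_cong) (auto simp: algebra_simps)
    also have "\<dots> = \<alpha> * (fC x * E (\<lambda>y. j1 y * f y) x) +
        \<beta> * (fD x * (e2 x * E (\<lambda>y. j0 y * f y) x - e0 x * E (\<lambda>y. j2 y * f y) x))"
      unfolding E_def using i by simp
    finally show ?thesis .
  qed
  have \<rho>abs: "\<bar>\<rho> z\<bar> \<le> 1" for z using \<rho>0[of z] \<rho>1[of z] by simp
  have m\<pi>: "\<rho> \<in> borel_measurable \<pi>" "snd \<in> \<pi> \<rightarrow>\<^sub>M (borel :: real measure)"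
    using \<rho>m unfolding measurable_cong_sets[OF s\<pi> refl] by (simp_all add: borel_prod[symmetric])
  have intN: "(\<integral>y. f y \<partial>N) = (\<integral>x. E (\<lambda>y. \<rho> (x, y) * f y) x \<partial>\<mu>)"
    if [measurable]: "f \<in> borel_measurable borel" and b: "\<And>y. \<bar>f y\<bar> \<le> B" for f B
  proof -
    have "(\<integral>y. f y \<partial>N) = (\<integral>z. f (snd z) \<partial>density \<pi> \<rho>)"
      unfolding N_def using m\<pi> by (subst integral_distr) simp_all
    also have "\<dots> = (\<integral>z. \<rho> z * f (snd z) \<partial>\<pi>)"
      using m\<pi> \<rho>0 by (subst integral_real_density) auto
    also have "\<dots> = (\<integral>x. (\<integral>y. \<rho> (x, y) * f (snd (x, y)) \<partial>\<kappa> x) \<partial>\<mu>)"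
    proof (rule integral_disintegration(2)[OF d s\<pi> \<mu>(2) \<mu>(1), of _ B])
      show "(\<lambda>z. \<rho> z * f (snd z)) \<in> borel_measurable borel"
        by (simp add: borel_prod[symmetric])
    qed (use prod1 \<rho>abs b in auto)
    finally show ?thesis by (simp add: E_def)
  qed
  have sN [measurable_cong]: "sets N = sets borel" by (simp add: N_def)
  interpret \<pi>: prob_space \<pi> by (rule prob_space_disintegration[OF d s\<pi> \<mu>])
  have "integrable \<pi> \<rho>"
    by (rule \<pi>.integrable_const_bound[of _ 1]) (use \<rho>abs m\<pi> in auto)
  then have "(\<integral>\<^sup>+ z. \<rho> z \<partial>\<pi>) \<noteq> \<infinity>"
    using \<rho>0 by (simp add: nn_integral_eq_integral)
  then have "finite_measure (density \<pi> \<rho>)"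
    using m\<pi>(1) by (intro finite_measureI) (simp add: emeasure_density cong: nn_integral_cong)
  then interpret N: finite_measure N
    unfolding N_def using m\<pi>(2) by (intro finite_measure.finite_measure_distr) simp_all
  have Ni: "integrable N f" if "f \<in> borel_measurable borel" "\<And>y. \<bar>f y\<bar> \<le> B"
    for f :: "real \<Rightarrow> real" and B
    by (rule N.integrable_const_bound[of _ B]) (use that in auto)
  have E0: "E (\<lambda>_. 0) x = 0" for x by (simp add: Econst)
  have iN: "integrable N j0" "integrable N j1" "integrable N j2" "integrable N d0" "integrable N d1" "integrable N d2"
    by (rule Ni[of _ 1]; use jabs in simp)+ (rule Ni[of _ "2 * K"]; use dabs in simp)+
  have jj': "j1 y * j0 y = 0" "j2 y * j0 y = 0" "j2 y * j1 y = 0" for y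
    using jj[of y] by (simp_all add: mult.commute)
  have jd: "j0 y * d0 y = d0 y" "j0 y * d1 y = 0" "j0 y * d2 y = 0" "j1 y * d0 y = 0" "j1 y * d1 y = d1 y"
     "j1 y * d2 y = 0" "j2 y * d0 y = 0" "j2 y * d1 y = 0" "j2 y * d2 y = d2 y" for y
    unfolding d0_def d1_def d2_def mult.assoc[symmetric] jj jj' by simp_all
  have eta: "E (\<lambda>y. j0 y) = m0" "E (\<lambda>y. j1 y) = m1" "E (\<lambda>y. j2 y) = m2"
    "E (\<lambda>y. d0 y) = e0" "E (\<lambda>y. d1 y) = e1" "E (\<lambda>y. d2 y) = e2"
    by (simp_all add: m0_def m1_def m2_def e0_def e1_def e2_def)
  \<comment> \<open>\<open>N\<close> has mass \<open>n0\<close>, \<open>n1\<close>,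
    \<open>n2\<close> on the intervals. Its moment about \<open>r\<close> is \<open>q\<close> on
    \<open>I2\<close> and \<open>- q\<close> on \<open>I0\<close>, because every fibre over
    \<open>D\<close> is balanced about \<open>r\<close>, and 0 on \<open>I1\<close> by
    \<open>fCe1\<close>.\<close>
  define n0 n1 n2 q where "n0 = (\<integral>y. j0 y \<partial>N)" and "n1 = (\<integral>y. j1 y \<partial>N)" and "n2 = (\<integral>y. j2 y \<partial>N)"
    and "q = (\<integral>y. d2 y \<partial>N)"
  have n0_eq: "n0 = \<beta> * (\<integral>x. fD x * (e2 x * m0 x) \<partial>\<mu>)"
    unfolding n0_def by (subst intN[of _ 1]; (subst E\<rho>[of _ 1])?) (simp_all add: jj jj' jabs E0 eta)
  have n1_eq: "n1 = \<alpha> * W"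
    unfolding n1_def W_def by (subst intN[of _ 1]; (subst E\<rho>[of _ 1])?) (simp_all add: jj jj' jabs E0 eta)
  have n2_eq: "n2 = \<beta> * (\<integral>x. fD x * - (e0 x * m2 x) \<partial>\<mu>)"
    unfolding n2_def by (subst intN[of _ 1]; (subst E\<rho>[of _ 1])?) (simp_all add: jj jj' jabs E0 eta)
  have q_eq: "q = \<beta> * (\<integral>x. fD x * - (e0 x * e2 x) \<partial>\<mu>)"
    unfolding q_def by (subst intN[of _ "2 * K"]; (subst E\<rho>[of _ "2 * K"])?) (simp_all add: jd dabs E0 eta K0)
  have "(\<integral>y. d0 y \<partial>N) = \<beta> * (\<integral>x. fD x * (e2 x * e0 x) \<partial>\<mu>)"
    by (subst intN[of _ "2 * K"]; (subst E\<rho>[of _ "2 * K"])?) (simp_all add: jd dabs E0 eta K0)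
  then have d0N: "(\<integral>y. d0 y \<partial>N) = - q"
    by (simp add: q_eq mult.commute)
  have d1N: "(\<integral>y. d1 y \<partial>N) = 0"
    by (subst intN[of _ "2 * K"]; (subst E\<rho>[of _ "2 * K"])?) (simp_all add: jd dabs E0 eta K0 fCe1)
  have prod2: "\<bar>u * v\<bar> \<le> 2 * K * B" if "\<bar>u\<bar> \<le> 2 * K" "\<bar>v\<bar> \<le> B" for u v B :: real
    using that mult_mono[of "\<bar>u\<bar>" "2 * K" "\<bar>v\<bar>" B] K0 by (simp add: abs_mult)
  have iD: "integrable \<mu> (\<lambda>x. fD x * (e2 x * m0 x))" "integrable \<mu> (\<lambda>x. fD x * - (e0 x * m2 x))"
    by (rule \<mu>i[of _ "2 * K * 1"]; use prod1[OF jabs(5)] prod2[OF eabs(1) mabs(3)] prod2[OF eabs(3) mabs(1)] in simp)+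
  have iD': "integrable \<mu> (\<lambda>x. fD x * - (e0 x * e2 x))"
    by (rule \<mu>i[of _ "2 * K * (2 * K)"]; use prod1[OF jabs(5)] prod2[OF eabs(1) eabs(3)] in simp)
  have n02: "n0 + n2 = n1"
  proof -
    have "n0 + n2 = \<beta> * (\<integral>x. fD x * (e2 x * m0 x) + fD x * - (e0 x * m2 x) \<partial>\<mu>)"
      unfolding n0_eq n2_eq by (simp only: Bochner_Integration.integral_add[OF iD] distrib_left)
    also have "\<dots> = \<beta> * G"
      unfolding G_def g_def by (simp add: algebra_simps)
    finally show ?thesis by (simp add: n1_eq \<alpha>\<beta>)
  qed
  have n1_pos: "0 < n1" using \<alpha> W_pos by (simp add: n1_eq)
  have n0_nonneg: "0 \<le> n0" "0 \<le> n2"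
    unfolding n0_def n2_def using j01 by simp_all
  have "0 < (\<integral>x. fD x * - (e0 x * e2 x) \<partial>\<mu>)"
  proof (rule integral_pos_of_pos_on[OF iD', of D])
    show "0 \<le> fD x * - (e0 x * e2 x)" for x
      using j01 e_sgn by (simp add: mult_nonpos_nonneg mult_nonneg_nonpos)
    show "0 < fD x * - (e0 x * e2 x)" if "x \<in> D" for x
      using that e0_neg e2_pos by (simp add: ind1 mult_neg_pos)
  qed (use \<mu>CD \<mu>(2) in simp_all)
  then have q_pos: "0 < q" using \<beta> by (simp add: q_eq mult_pos_neg)
  \<comment> \<open>Division-free form of: the barycentre of \<open>N\<close> on \<open>I2\<close>
    is at least \<open>z2\<close>, the one on \<open>I0\<close> at most \<open>z1\<close>.\<close>
  have q_ge: "n2 * (z2 - r) \<le> q" "n0 * (r - z1) \<le> q"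
  proof -
    have le: "j2 y * (z2 - r) \<le> d2 y" "d0 y \<le> j0 y * (z1 - r)" for y
      using Isub by (auto simp: d0_def d2_def j0_def j2_def indicator_def)
    have "(\<integral>y. j2 y * (z2 - r) \<partial>N) \<le> q"
      unfolding q_def by (rule integral_mono) (use iN le in auto)
    then show "n2 * (z2 - r) \<le> q" using iN by (simp add: n2_def)
    have "(\<integral>y. d0 y \<partial>N) \<le> (\<integral>y. j0 y * (z1 - r) \<partial>N)"
      by (rule integral_mono) (use iN le in auto)
    then show "n0 * (r - z1) \<le> q" using iN by (simp add: n0_def d0N algebra_simps)
  qed
  text \<open>
    Over \<open>x \<in> D\<close> a multiple of \<open>N\<close> on \<open>I1\<close> is put back. Over \<open>x \<in> C\<close> the multiples of \<open>N\<close> on \<open>I0\<close>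
    and \<open>I2\<close> are determined by the mass and barycentre conditions, a linear system solved by
    \<open>a0\<close> and \<open>a2\<close> (up to the factor \<open>\<alpha> / n1\<close>); they are nonnegative because \<open>I1\<close> lies between
    the barycentres of \<open>N\<close> on \<open>I0\<close> and on \<open>I2\<close>.
  \<close>
  define a0 a2 where "a0 x = m1 x - n2 / q * e1 x" and "a2 x = m1 x + n0 / q * e1 x" for x
  have [measurable]: "a0 \<in> borel_measurable borel" "a2 \<in> borel_measurable borel"
    by (simp_all add: a0_def[abs_def] a2_def[abs_def])
  have a_nonneg: "0 \<le> a0 x" "0 \<le> a2 x" for x
  proof -
    have "n2 * e1 x \<le> n2 * ((z2 - r) * m1 x)" "n0 * ((z1 - r) * m1 x) \<le> n0 * e1 x"
      using e1_bd[of x] n0_nonneg by (simp_all add: mult_left_mono)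
    moreover have "n2 * (z2 - r) * m1 x \<le> q * m1 x" "n0 * (r - z1) * m1 x \<le> q * m1 x"
      using q_ge m01[of x] by (simp_all add: mult_right_mono)
    ultimately have "n2 * e1 x \<le> q * m1 x" "- (n0 * e1 x) \<le> q * m1 x"
      by (auto simp: algebra_simps)
    then show "0 \<le> a0 x" "0 \<le> a2 x"
      using q_pos by (simp_all add: a0_def a2_def field_simps)
  qed
  have a_le: "a0 x \<le> 1 + n2 / q * (2 * K)" "a2 x \<le> 1 + n0 / q * (2 * K)" for x
  proof -
    have "n2 / q * - e1 x \<le> n2 / q * (2 * K)" "n0 / q * e1 x \<le> n0 / q * (2 * K)"
      using eabs(2)[of x] n0_nonneg q_pos by (intro mult_left_mono; auto simp: abs_le_iff)+
    then show "a0 x \<le> 1 + n2 / q * (2 * K)" "a2 x \<le> 1 + n0 / q * (2 * K)"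
      using m01[of x] by (simp_all add: a0_def a2_def)
  qed
  define A where "A = (\<lambda>(x, y). \<beta> / n1 * (fD x * g x) * j1 y + \<alpha> / n1 * fC x * (a0 x * j0 y + a2 x * j2 y))"
  define L where "L = \<beta> / n1 * (4 * K) + \<alpha> / n1 * ((1 + n2 / q * (2 * K)) + (1 + n0 / q * (2 * K)))"
  have [measurable]: "A \<in> borel_measurable (borel \<Otimes>\<^sub>M borel)" unfolding A_def by measurable
  have Am: "A \<in> borel_measurable borel" using \<open>A \<in> borel_measurable (borel \<Otimes>\<^sub>M borel)\<close> by (simp add: borel_prod)
  have A0: "0 \<le> A z" for z
    using j01 g a_nonneg \<alpha> \<beta> n1_pos by (auto simp: A_def split_beta')
  have AL: "A z \<le> L" for z
  proof -
    obtain x y where z: "z = (x, y)" by force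
    have "fD x * g x * j1 y \<le> 4 * K"
      using prod1[OF jabs(2)[of y] prod1[OF jabs(5)[of x] g(2)[of x]]] by (simp add: mult_ac abs_le_iff)
    then have 1: "\<beta> / n1 * (fD x * g x * j1 y) \<le> \<beta> / n1 * (4 * K)"
      using \<beta> n1_pos by (intro mult_left_mono) auto
    have "a0 x * j0 y + a2 x * j2 y \<le> a0 x * 1 + a2 x * 1"
      using a_nonneg[of x] j01 by (intro add_mono mult_left_mono) auto
    also have "\<dots> \<le> (1 + n2 / q * (2 * K)) + (1 + n0 / q * (2 * K))"
      using a_le[of x] by simp
    finally have "a0 x * j0 y + a2 x * j2 y \<le> \<dots>" .
    moreover have "fC x * (a0 x * j0 y + a2 x * j2 y) \<le> a0 x * j0 y + a2 x * j2 y"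
      using j01 a_nonneg[of x] by (intro mult_left_le_one_le) auto
    ultimately have "fC x * (a0 x * j0 y + a2 x * j2 y) \<le> (1 + n2 / q * (2 * K)) + (1 + n0 / q * (2 * K))"
      by (rule order_trans[rotated])
    then have "\<alpha> / n1 * (fC x * (a0 x * j0 y + a2 x * j2 y)) \<le>
        \<alpha> / n1 * ((1 + n2 / q * (2 * K)) + (1 + n0 / q * (2 * K)))"
      using \<alpha> n1_pos by (intro mult_left_mono) auto
    with 1 show ?thesis by (simp add: z A_def L_def mult.assoc)
  qed
  have As: "z \<in> D \<times> I1 \<union> C \<times> (I0 \<union> I2)" if "A z \<noteq> 0" for z
    using that by (cases z) (auto simp: A_def fC_def fD_def j0_def j1_def j2_def indicator_def split: if_splits)

  \<comment> \<open>Removed and added part agree in mass, barycentre and second marginal\<close>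
  have mass\<rho>: "(\<integral>y. \<rho> (x, y) \<partial>\<kappa> x) = \<alpha> * (fC x * m1 x) + \<beta> * (fD x * g x)" for x
    using E\<rho>[of "\<lambda>_. 1" 1 x] by (simp add: E_def jabs g_def m0_def m1_def m2_def)
  have massA: "(\<integral>y. A (x, y) \<partial>N) = \<alpha> * (fC x * m1 x) + \<beta> * (fD x * g x)" for x
  proof -
    have "(\<integral>y. A (x, y) \<partial>N) = \<beta> / n1 * (fD x * g x) * n1 + \<alpha> / n1 * fC x * (a0 x * n0 + a2 x * n2)"
      using iN by (simp add: A_def n0_def n1_def n2_def)
    also have "a0 x * n0 + a2 x * n2 = (n0 + n2) * m1 x"
      by (simp add: a0_def a2_def algebra_simps)
    finally show ?thesis using n1_pos n02 by simp
  qed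
  \<comment> \<open>About \<open>r\<close> the contribution over \<open>D\<close> vanishes on both
    sides, by balance for \<rho> and by \<open>d1N\<close> for \<open>A\<close>. Moments about 0
    follow in \<open>mean\<close> because the masses agree.\<close>
  have mean\<rho>: "(\<integral>y. \<rho> (x, y) * (y - r) \<partial>\<kappa> x) = \<alpha> * (fC x * e1 x)" for x
    using E\<rho>[of "\<lambda>y. y - r" "2 * K" x] dabs
    by (simp add: E_def d0_def d1_def d2_def e0_def e1_def e2_def mult.commute)
  have meanA: "(\<integral>y. A (x, y) * (y - r) \<partial>N) = \<alpha> * (fC x * e1 x)" for x
  proof -
    have "(\<integral>y. A (x, y) * (y - r) \<partial>N) =
        (\<integral>y. \<beta> / n1 * (fD x * g x) * d1 y + \<alpha> / n1 * fC x * (a0 x * d0 y + a2 x * d2 y) \<partial>N)"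
      by (rule Bochner_Integration.integral_cong) (auto simp: A_def d0_def d1_def d2_def algebra_simps add_divide_distrib diff_divide_distrib)
    also have "\<dots> = \<alpha> / n1 * fC x * (a0 x * - q + a2 x * q)"
      using iN by (simp add: d0N d1N q_def)
    also have "a0 x * - q + a2 x * q = (n0 + n2) * e1 x"
      using q_pos by (simp add: a0_def a2_def field_simps)
    finally show ?thesis using n1_pos n02 by simp
  qed
  have mean: "(\<integral>y. A (x, y) * y \<partial>N) = (\<integral>y. \<rho> (x, y) * y \<partial>\<kappa> x)" for x
  proof -
    have bd: "\<bar>\<rho> (x, y) * (y - r)\<bar> \<le> 2 * K" "\<bar>A (x, y) * (y - r)\<bar> \<le> 2 * K * L" for y
    proof -
      have *: "\<bar>y - r\<bar> \<le> 2 * K" if "y \<in> I0 \<union> I1 \<union> I2"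
        using that Isub z rK by (auto simp: abs_le_iff)
      show "\<bar>\<rho> (x, y) * (y - r)\<bar> \<le> 2 * K"
        using prod1[OF \<rho>abs *] \<rho>s[of "(x, y)"] K0 by (cases "\<rho> (x, y) = 0") auto
      have "\<bar>A (x, y)\<bar> \<le> L" "0 \<le> L" using A0[of "(x, y)"] AL[of "(x, y)"] by auto
      then show "\<bar>A (x, y) * (y - r)\<bar> \<le> 2 * K * L"
        using prod2[OF *, of "A (x, y)" L] As[of "(x, y)"] K0
        by (cases "A (x, y) = 0") (auto simp: mult.commute)
    qed
    have i: "integrable N (\<lambda>y. A (x, y) * (y - r))" "integrable (\<kappa> x) (\<lambda>y. \<rho> (x, y) * (y - r))"
        "integrable N (\<lambda>y. r * A (x, y))" "integrable (\<kappa> x) (\<lambda>y. r * \<rho> (x, y))"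
      by (rule Ni[of _ "2 * K * L"] Ei[of _ "2 * K"] integrable_mult_right[OF Ni[of _ L]]
          integrable_mult_right[OF Ei[of _ 1]]; use bd \<rho>abs A0 AL in simp)+
    have "(\<integral>y. A (x, y) * y \<partial>N) = (\<integral>y. A (x, y) * (y - r) + r * A (x, y) \<partial>N)"
      by (simp add: algebra_simps)
    also have "\<dots> = (\<integral>y. \<rho> (x, y) * (y - r) + r * \<rho> (x, y) \<partial>\<kappa> x)"
      using i by (simp add: mean\<rho> meanA mass\<rho> massA)
    also have "\<dots> = (\<integral>y. \<rho> (x, y) * y \<partial>\<kappa> x)"
      by (simp add: algebra_simps)
    finally show ?thesis .
  qed
  have i_fCa: "integrable \<mu> (\<lambda>x. fC x * e1 x)"
    by (rule \<mu>i[of _ "2 * K"]) (use prod1 jabs eabs in auto)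
  \<comment> \<open>The terms with \<open>e1\<close> in \<open>a0\<close> and \<open>a2\<close>
    integrate to zero by \<open>fCe1\<close>. What remains is normalised since \<open>n1\<close>
    equals both \<open>\<alpha> * W\<close> and \<open>\<beta> * G\<close>.\<close>
  have marg: "(\<integral>x. A (x, y) \<partial>\<mu>) = j0 y + j1 y + j2 y" for y
  proof -
    have "(\<integral>x. A (x, y) \<partial>\<mu>) = (\<integral>x. \<beta> / n1 * j1 y * (fD x * g x) + \<alpha> / n1 * (j0 y + j2 y) * (fC x * m1 x) +
        \<alpha> / n1 * (j2 y * (n0 / q) - j0 y * (n2 / q)) * (fC x * e1 x) \<partial>\<mu>)"
      by (rule Bochner_Integration.integral_cong) (auto simp: A_def a0_def a2_def algebra_simps)
    also have "\<dots> = \<beta> / n1 * j1 y * G + \<alpha> / n1 * (j0 y + j2 y) * W"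
      using i_fDg i_fCm1 i_fCa by (simp add: fCe1 G_def W_def)
    also have "\<dots> = j1 y * (\<beta> * G) / n1 + (j0 y + j2 y) * (\<alpha> * W) / n1"
      by (simp add: mult_ac)
    finally show ?thesis using n1_pos by (simp add: \<alpha>\<beta>[symmetric] n1_eq[symmetric])
  qed
  \<comment> \<open>The marginal of \<open>A\<close> is 1 only on the three intervals, but \<rho>
    lives above these, so \<open>N\<close> does not charge the complement, whose indicator is
    \<open>w\<close>.\<close>
  have Nconc: "AE y in N. j0 y + j1 y + j2 y = 1"
  proof -
    define w where "w y = 1 - j0 y - j1 y - j2 y" for y
    have [measurable]: "w \<in> borel_measurable borel" by (simp add: w_def[abs_def])
    have w: "0 \<le> w y" "w y \<le> 1" "\<bar>w y\<bar> \<le> 1" "j0 y * w y = 0" "j1 y * w y = 0" "j2 y * w y = 0" for y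
      using jj[of y] by (auto simp: w_def j0_def j1_def j2_def indicator_def split: if_splits)
    have "(\<integral>y. w y \<partial>N) = 0"
      by (subst intN[of _ 1]; (subst E\<rho>[of _ 1])?) (simp_all add: w E0)
    moreover have "integrable N w"
      by (rule Ni[of _ 1]) (simp_all add: w)
    ultimately have "AE y in N. w y = 0"
      using integral_nonneg_eq_0_iff_AE[of N w] w(1) by simp
    then show ?thesis by eventually_elim (simp add: w_def)
  qed
  have \<rho>pos: "0 < (\<integral>z. \<rho> z \<partial>\<pi>)"
  proof -
    have "(\<integral>z. \<rho> z \<partial>\<pi>) = (\<integral>x. \<alpha> * (fC x * m1 x) + \<beta> * (fD x * g x) \<partial>\<mu>)"
      using integral_disintegration(2)[OF d s\<pi> \<mu>(2) \<mu>(1) \<rho>m \<rho>abs] by (simp add: mass\<rho>)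
    also have "\<dots> = \<alpha> * W + \<beta> * G"
      using i_fCm1 i_fDg by (simp add: W_def G_def)
    finally show ?thesis using \<alpha> \<beta> W_pos G_pos by (simp add: add_pos_pos)
  qed
  show thesis
    by (rule that[OF \<rho>m \<rho>0 \<rho>1 Am A0 AL \<rho>s As N_def _ mean _ \<rho>pos])
      (use Nconc in \<open>auto simp: massA mass\<rho> marg\<close>)
qed

text \<open>
  Terms of the form \<open>\<phi> y + \<psi> x * (a * y + b)\<close> have the same integral against the removed and the
  added part, so only the difference between \<open>c\<close> and such a term matters for the comparison.
\<close>
lemma optimal_martingale_plan_no_swap:
  fixes c :: "real \<Rightarrow> real \<Rightarrow> real" and \<phi> \<psi> :: "real \<Rightarrow> real"
  assumes opt: "optimal_martingale_plan c \<mu> \<nu> \<pi>"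
    and c: "integrable \<pi> (\<lambda>(x, y). c x y)" "(\<lambda>(x, y). c x y) \<in> borel_measurable borel"
    and d: "disintegration \<pi> \<mu> \<kappa>"
    and mart: "AE x in \<mu>. integrable (\<kappa> x) (\<lambda>y. y) \<and> (\<integral>y. y \<partial>\<kappa> x) = x"
    and \<mu>: "prob_space \<mu>" "sets \<mu> = sets borel"
    and CD [measurable]: "C \<in> sets borel" "D \<in> sets borel" "C \<inter> D = {}"
    and \<mu>CD: "emeasure \<mu> C \<noteq> 0" "emeasure \<mu> D \<noteq> 0"
    and I: "I0 \<in> sets borel" "I1 \<in> sets borel" "I2 \<in> sets borel"
    and Isub: "I0 \<subseteq> {-K..<z1}" "I1 \<subseteq> {z1..z2}" "I2 \<subseteq> {z2<..K}"
    and z: "-K \<le> z1" "z1 \<le> z2" "z2 \<le> K"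
    and \<kappa>C: "\<And>x. x \<in> C \<Longrightarrow> emeasure (\<kappa> x) I1 \<noteq> 0"
    and \<kappa>D: "\<And>x. x \<in> D \<Longrightarrow> emeasure (\<kappa> x) I0 \<noteq> 0" "\<And>x. x \<in> D \<Longrightarrow> emeasure (\<kappa> x) I2 \<noteq> 0"
    and c_bd: "\<And>x y. x \<in> C \<union> D \<Longrightarrow> y \<in> {-K..K} \<Longrightarrow> \<bar>c x y\<bar> \<le> M"
    and \<phi>: "\<phi> \<in> borel_measurable borel" "\<And>y. y \<in> {-K..K} \<Longrightarrow> \<bar>\<phi> y\<bar> \<le> M"
    and \<psi>: "\<psi> \<in> borel_measurable borel" "\<And>x. x \<in> C \<union> D \<Longrightarrow> \<bar>\<psi> x\<bar> \<le> M"
    and gt: "\<And>x y. (x, y) \<in> C \<times> I1 \<union> D \<times> (I0 \<union> I2) \<Longrightarrow> \<phi> y + \<psi> x * (a * y + b) < c x y"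
    and lt: "\<And>x y. (x, y) \<in> D \<times> I1 \<union> C \<times> (I0 \<union> I2) \<Longrightarrow> c x y \<le> \<phi> y + \<psi> x * (a * y + b)"
  shows False
proof -
  obtain \<rho> A L N where
        \<rho>: "\<rho> \<in> borel_measurable borel" "\<And>z. 0 \<le> \<rho> z" "\<And>z. \<rho> z \<le> 1"
    and A: "A \<in> borel_measurable borel" "\<And>z. 0 \<le> A z" "\<And>z. A z \<le> L"
    and \<rho>s: "\<And>z. \<rho> z \<noteq> 0 \<Longrightarrow> z \<in> C \<times> I1 \<union> D \<times> (I0 \<union> I2)"
    and As: "\<And>z. A z \<noteq> 0 \<Longrightarrow> z \<in> D \<times> I1 \<union> C \<times> (I0 \<union> I2)"
    and N: "N = distr (density \<pi> \<rho>) borel snd"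
    and mass: "\<And>x. (\<integral>y. A (x, y) \<partial>N) = (\<integral>y. \<rho> (x, y) \<partial>\<kappa> x)"
    and mean: "\<And>x. (\<integral>y. A (x, y) * y \<partial>N) = (\<integral>y. \<rho> (x, y) * y \<partial>\<kappa> x)"
    and marg: "AE y in N. (\<integral>x. A (x, y) \<partial>\<mu>) = 1"
    and \<rho>pos: "0 < (\<integral>z. \<rho> z \<partial>\<pi>)"
  proof -
    have s\<pi>: "sets \<pi> = sets borel"
      using opt by (auto simp: optimal_martingale_plan_def martingale_plans_def)
    show thesis
      by (rule swap_perturbation[OF d s\<pi> \<mu> CD \<mu>CD I Isub z \<kappa>C \<kappa>D]; (assumption | rule that; assumption)?)
  qed
  have s\<pi>: "sets \<pi> = sets borel"
    using opt by (auto simp: optimal_martingale_plan_def martingale_plans_def)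
  interpret \<mu>: prob_space \<mu> by fact
  interpret \<kappa>: prob_space "\<kappa> x" for x by (rule disintegrationD[OF d])
  have sN: "sets N = sets borel" by (simp add: N)
  note [measurable_cong] = s\<pi> \<mu>(2) disintegrationD(2)[OF d] sN
  have [measurable]: "\<rho> \<in> borel_measurable (borel \<Otimes>\<^sub>M borel)" "A \<in> borel_measurable (borel \<Otimes>\<^sub>M borel)"
      "(\<lambda>(x, y). c x y) \<in> borel_measurable (borel \<Otimes>\<^sub>M borel)"
    using \<rho> A c by (simp_all add: borel_prod)
  note [measurable] = \<phi>(1) \<psi>(1) I
  have K0: "0 \<le> K" using z by simp
  have sub: "I0 \<union> I1 \<union> I2 \<subseteq> {-K..K}" using Isub z by fastforce
  have \<rho>box: "x \<in> C \<union> D" "y \<in> {-K..K}" if "\<rho> (x, y) \<noteq> 0" for x y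
    using \<rho>s[OF that] sub by auto
  have Abox: "x \<in> C \<union> D" "y \<in> {-K..K}" if "A (x, y) \<noteq> 0" for x y
    using As[OF that] sub by auto
  interpret \<pi>: prob_space \<pi> by (rule prob_space_disintegration[OF d s\<pi> \<mu>])
  have \<rho>abs: "\<bar>\<rho> z\<bar> \<le> 1" for z using \<rho>(2,3)[of z] by simp
  have m\<pi>: "\<rho> \<in> borel_measurable \<pi>" "snd \<in> \<pi> \<rightarrow>\<^sub>M (borel :: real measure)"
    using \<rho>(1) unfolding measurable_cong_sets[OF s\<pi> refl] by (simp_all add: borel_prod[symmetric])
  have i\<rho>: "integrable \<pi> \<rho>"
    by (rule \<pi>.integrable_const_bound[of _ 1]) (use \<rho>abs m\<pi> in auto)
  then have "(\<integral>\<^sup>+ z. \<rho> z \<partial>\<pi>) \<noteq> \<infinity>"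
    using \<rho>(2) by (simp add: nn_integral_eq_integral)
  then have "finite_measure (density \<pi> \<rho>)"
    using m\<pi>(1) by (intro finite_measureI) (simp add: emeasure_density cong: nn_integral_cong)
  then interpret N: finite_measure N
    unfolding N using m\<pi>(2) by (intro finite_measure.finite_measure_distr) simp_all
  interpret P: pair_sigma_finite \<mu> N ..
  interpret Q: finite_measure "\<mu> \<Otimes>\<^sub>M N"
    by (rule finite_measure_pair_measure) unfold_locales
  have sP: "sets (\<mu> \<Otimes>\<^sub>M N) = sets borel"
    using sets_pair_measure_cong[OF \<mu>(2) sN] unfolding borel_prod .
  have i\<pi>: "integrable \<pi> f" if "f \<in> borel_measurable borel" "\<And>z. \<bar>f z\<bar> \<le> B"
    for f :: "real \<times> real \<Rightarrow> real" and B
    by (rule \<pi>.integrable_const_bound[of _ B])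
      (use that in \<open>auto simp: measurable_cong_sets[OF s\<pi> refl]\<close>)
  have iQ: "integrable (\<mu> \<Otimes>\<^sub>M N) f" if "f \<in> borel_measurable borel" "\<And>z. \<bar>f z\<bar> \<le> B"
    for f :: "real \<times> real \<Rightarrow> real" and B
    by (rule Q.integrable_const_bound[of _ B])
      (use that in \<open>auto simp: measurable_cong_sets[OF sP refl]\<close>)
  have L0: "0 \<le> L" using A(2,3)[of "(0, 0)"] by simp
  have M0: "0 \<le> M" using \<phi>(2)[of 0] K0 by simp
  have \<rho>B: "\<bar>\<rho> (x, y) * w\<bar> \<le> B" if "x \<in> C \<union> D \<Longrightarrow> y \<in> {-K..K} \<Longrightarrow> \<bar>w\<bar> \<le> B" "0 \<le> B" for x y w B
    using that \<rho>box[of x y] mult_mono[of "\<bar>\<rho> (x, y)\<bar>" 1 "\<bar>w\<bar>" B] \<rho>abs[of "(x, y)"]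
    by (cases "\<rho> (x, y) = 0") (auto simp: abs_mult)
  have AB: "\<bar>A (x, y) * w\<bar> \<le> L * B" if "x \<in> C \<union> D \<Longrightarrow> y \<in> {-K..K} \<Longrightarrow> \<bar>w\<bar> \<le> B" "0 \<le> B" for x y w B
    using that Abox[of x y] mult_mono[of "\<bar>A (x, y)\<bar>" L "\<bar>w\<bar>" B] A(2,3)[of "(x, y)"] L0
    by (cases "A (x, y) = 0") (auto simp: abs_mult)
  define l where "l y = a * y + b" for y
  define \<Lambda> where "\<Lambda> = \<bar>a\<bar> * K + \<bar>b\<bar>"
  have [measurable]: "l \<in> borel_measurable borel" by (simp add: l_def[abs_def])
  have \<Lambda>0: "0 \<le> \<Lambda>" using K0 by (simp add: \<Lambda>_def)
  have l: "\<bar>l y\<bar> \<le> \<Lambda>" if "y \<in> {-K..K}" for y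
  proof -
    have "\<bar>a * y\<bar> \<le> \<bar>a\<bar> * K" using that by (auto simp: abs_mult intro!: mult_left_mono)
    then show ?thesis by (auto simp: l_def \<Lambda>_def)
  qed
  have \<psi>l: "\<bar>\<psi> x * l y\<bar> \<le> M * \<Lambda>" if "x \<in> C \<union> D" "y \<in> {-K..K}" for x y
    unfolding abs_mult using \<psi>(2)[OF that(1)] l[OF that(2)] M0 by (intro mult_mono) auto
  have int\<rho>: "integrable \<pi> (\<lambda>(x, y). \<rho> (x, y) * w x y)"
    if [measurable]: "(\<lambda>(x, y). w x y) \<in> borel_measurable (borel \<Otimes>\<^sub>M borel)"
      and b: "\<And>x y. x \<in> C \<union> D \<Longrightarrow> y \<in> {-K..K} \<Longrightarrow> \<bar>w x y\<bar> \<le> B" "0 \<le> B" for w B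
  proof -
    have "(\<lambda>z. \<rho> z * (case z of (x, y) \<Rightarrow> w x y)) \<in> borel_measurable (borel \<Otimes>\<^sub>M borel)"
      by measurable
    moreover have "\<bar>\<rho> z * (case z of (x, y) \<Rightarrow> w x y)\<bar> \<le> B" for z
      using \<rho>B[OF b, of "fst z" "snd z"] by (simp add: split_beta')
    ultimately have "integrable \<pi> (\<lambda>z. \<rho> z * (case z of (x, y) \<Rightarrow> w x y))"
      by (intro i\<pi>[of _ B]) (simp_all add: borel_prod)
    then show ?thesis by (simp add: split_beta')
  qed
  have intA: "integrable (\<mu> \<Otimes>\<^sub>M N) (\<lambda>(x, y). A (x, y) * w x y)"
    if [measurable]: "(\<lambda>(x, y). w x y) \<in> borel_measurable (borel \<Otimes>\<^sub>M borel)"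
      and b: "\<And>x y. x \<in> C \<union> D \<Longrightarrow> y \<in> {-K..K} \<Longrightarrow> \<bar>w x y\<bar> \<le> B" "0 \<le> B" for w B
  proof -
    have "(\<lambda>z. A z * (case z of (x, y) \<Rightarrow> w x y)) \<in> borel_measurable (borel \<Otimes>\<^sub>M borel)"
      by measurable
    moreover have "\<bar>A z * (case z of (x, y) \<Rightarrow> w x y)\<bar> \<le> L * B" for z
      using AB[OF b, of "fst z" "snd z"] by (simp add: split_beta')
    ultimately have "integrable (\<mu> \<Otimes>\<^sub>M N) (\<lambda>z. A z * (case z of (x, y) \<Rightarrow> w x y))"
      by (intro iQ[of _ "L * B"]) (simp_all add: borel_prod)
    then show ?thesis by (simp add: split_beta')
  qed
  note bm = borel_prod[symmetric]

  \<comment> \<open>Both sides equal the integral of \<phi> against \<open>N\<close>, the second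
    marginal of both parts. The cutoff \<open>f\<close> replaces \<phi>, which is bounded only on
    the interval from -K to K, without changing the integrands.\<close>
  have \<phi>_eq: "(\<integral>(x, y). \<rho> (x, y) * \<phi> y \<partial>\<pi>) = (\<integral>(x, y). A (x, y) * \<phi> y \<partial>(\<mu> \<Otimes>\<^sub>M N))"
  proof -
    define f where "f y = indicator {-K..K} y * \<phi> y" for y
    have [measurable]: "f \<in> borel_measurable borel" by (simp add: f_def[abs_def])
    have f: "\<rho> (x, y) * \<phi> y = \<rho> (x, y) * f y" "A (x, y) * \<phi> y = A (x, y) * f y" for x y
      using \<rho>box[of x y] Abox[of x y] by (cases "\<rho> (x, y) = 0"; cases "A (x, y) = 0"; auto simp: f_def)+
    have "(\<integral>y. f y \<partial>N) = (\<integral>z. f (snd z) \<partial>density \<pi> \<rho>)"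
      unfolding N using m\<pi> by (subst integral_distr) simp_all
    also have "\<dots> = (\<integral>z. \<rho> z * f (snd z) \<partial>\<pi>)"
      using m\<pi> \<rho> by (subst integral_real_density) auto
    finally have 1: "(\<integral>(x, y). \<rho> (x, y) * \<phi> y \<partial>\<pi>) = (\<integral>y. f y \<partial>N)"
      by (simp add: f split_beta')
    have iA: "integrable (\<mu> \<Otimes>\<^sub>M N) (\<lambda>(x, y). A (x, y) * f y)"
    proof (rule iQ[of _ "L * M"])
      show "\<bar>case z of (x, y) \<Rightarrow> A (x, y) * f y\<bar> \<le> L * M" for z
        using AB[of "fst z" "snd z" "f (snd z)" M] \<phi>(2) M0 by (auto simp: f_def split_beta' indicator_def)
    qed (simp add: bm)
    then have "(\<integral>(x, y). A (x, y) * f y \<partial>(\<mu> \<Otimes>\<^sub>M N)) = (\<integral>y. (\<integral>x. A (x, y) * f y \<partial>\<mu>) \<partial>N)"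
      by (rule P.integral_snd[symmetric])
    also have "\<dots> = (\<integral>y. f y \<partial>N)"
      by (rule integral_cong_AE) (use marg in \<open>auto\<close>)
    finally show ?thesis unfolding 1 by (simp add: f)
  qed
  \<comment> \<open>Here equality holds fibrewise: for fixed x the integrand is affine in y, and
    affine functions see only the mass and the barycentre.\<close>
  have \<psi>_eq: "(\<integral>(x, y). \<rho> (x, y) * (\<psi> x * l y) \<partial>\<pi>) = (\<integral>(x, y). A (x, y) * (\<psi> x * l y) \<partial>(\<mu> \<Otimes>\<^sub>M N))"
  proof -
    have inner: "(\<integral>y. \<rho> (x, y) * (\<psi> x * l y) \<partial>\<kappa> x) = (\<integral>y. A (x, y) * (\<psi> x * l y) \<partial>N)" for x
    proof -
      have \<rho>y: "\<bar>\<rho> (x, y) * y\<bar> \<le> K" and Ay: "\<bar>A (x, y) * y\<bar> \<le> L * K" for y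
        using K0 by (auto intro!: \<rho>B AB)
      have i: "integrable (\<kappa> x) (\<lambda>y. \<rho> (x, y))" "integrable (\<kappa> x) (\<lambda>y. \<rho> (x, y) * y)"
        by (rule \<kappa>.integrable_const_bound[of _ 1] \<kappa>.integrable_const_bound[of _ K];
            simp add: \<rho>abs \<rho>y)+
      have j: "integrable N (\<lambda>y. A (x, y))" "integrable N (\<lambda>y. A (x, y) * y)"
        by (rule N.integrable_const_bound[of _ L] N.integrable_const_bound[of _ "L * K"];
            simp add: A Ay)+
      have "(\<integral>y. \<rho> (x, y) * (\<psi> x * l y) \<partial>\<kappa> x) =
          (\<integral>y. \<psi> x * (a * (\<rho> (x, y) * y) + b * \<rho> (x, y)) \<partial>\<kappa> x)"
        by (rule Bochner_Integration.integral_cong) (auto simp: l_def algebra_simps)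
      also have "\<dots> = (\<integral>y. \<psi> x * (a * (A (x, y) * y) + b * A (x, y)) \<partial>N)"
        using i j by (simp add: mass mean)
      also have "\<dots> = (\<integral>y. A (x, y) * (\<psi> x * l y) \<partial>N)"
        by (rule Bochner_Integration.integral_cong) (auto simp: l_def algebra_simps)
      finally show ?thesis .
    qed
    have "(\<integral>(x, y). \<rho> (x, y) * (\<psi> x * l y) \<partial>\<pi>) = (\<integral>x. (\<integral>y. \<rho> (x, y) * (\<psi> x * l y) \<partial>\<kappa> x) \<partial>\<mu>)"
    proof (subst integral_disintegration(2)[OF d s\<pi> \<mu>(2) \<mu>(1), of _ "M * \<Lambda>"])
      show "\<bar>case z of (x, y) \<Rightarrow> \<rho> (x, y) * (\<psi> x * l y)\<bar> \<le> M * \<Lambda>" for z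
        using \<rho>B[of "fst z" "snd z" "\<psi> (fst z) * l (snd z)" "M * \<Lambda>"] \<psi>l M0 \<Lambda>0 by (auto simp: split_beta')
    qed (simp_all add: bm)
    also have "\<dots> = (\<integral>(x, y). A (x, y) * (\<psi> x * l y) \<partial>(\<mu> \<Otimes>\<^sub>M N))"
      unfolding inner
    proof (rule P.integral_fst, rule iQ[of _ "L * (M * \<Lambda>)"])
      show "\<bar>case z of (x, y) \<Rightarrow> A (x, y) * (\<psi> x * l y)\<bar> \<le> L * (M * \<Lambda>)" for z
        using AB[of "fst z" "snd z" "\<psi> (fst z) * l (snd z)" "M * \<Lambda>"] \<psi>l M0 \<Lambda>0 by (auto simp: split_beta')
    qed (simp add: bm)
    finally show ?thesis .
  qed
  define F where "F = (\<lambda>(x, y). c x y - \<phi> y - \<psi> x * l y)"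
  have [measurable]: "F \<in> borel_measurable (borel \<Otimes>\<^sub>M borel)" unfolding F_def by measurable
  have F: "\<bar>F (x, y)\<bar> \<le> 2 * M + M * \<Lambda>" if "x \<in> C \<union> D" "y \<in> {-K..K}" for x y
    using c_bd[OF that] \<phi>(2)[OF that(2)] \<psi>l[OF that] by (auto simp: F_def)
  have M\<Lambda>: "0 \<le> M * \<Lambda>" "0 \<le> 2 * M + M * \<Lambda>" using M0 \<Lambda>0 by simp_all
  have i1: "integrable \<pi> (\<lambda>(x, y). \<rho> (x, y) * F (x, y))" "integrable \<pi> (\<lambda>(x, y). \<rho> (x, y) * \<phi> y)"
     "integrable \<pi> (\<lambda>(x, y). \<rho> (x, y) * (\<psi> x * l y))"
    using int\<rho>[of "\<lambda>x y. F (x, y)" "2 * M + M * \<Lambda>"] int\<rho>[of "\<lambda>x y. \<phi> y" M]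
      int\<rho>[of "\<lambda>x y. \<psi> x * l y" "M * \<Lambda>"] F \<phi>(2) \<psi>l M\<Lambda> M0
    by simp_all
  have i2: "integrable (\<mu> \<Otimes>\<^sub>M N) (\<lambda>(x, y). A (x, y) * F (x, y))" "integrable (\<mu> \<Otimes>\<^sub>M N) (\<lambda>(x, y). A (x, y) * \<phi> y)"
     "integrable (\<mu> \<Otimes>\<^sub>M N) (\<lambda>(x, y). A (x, y) * (\<psi> x * l y))" "integrable (\<mu> \<Otimes>\<^sub>M N) (\<lambda>(x, y). A (x, y) * c x y)"
    using intA[of "\<lambda>x y. F (x, y)" "2 * M + M * \<Lambda>"] intA[of "\<lambda>x y. \<phi> y" M]
      intA[of "\<lambda>x y. \<psi> x * l y" "M * \<Lambda>"] intA[of c M] F \<phi>(2) \<psi>l c_bd M\<Lambda> M0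
    by simp_all
  have \<rho>K: "\<bar>y\<bar> \<le> K" if "\<rho> (x, y) \<noteq> 0" for x y using \<rho>box(2)[OF that] by auto
  have AK: "\<bar>y\<bar> \<le> K" if "A (x, y) \<noteq> 0" for x y using Abox(2)[OF that] by auto
  have "(\<integral>(x, y). \<rho> (x, y) * c x y \<partial>\<pi>) \<le> (\<integral>(x, y). A (x, y) * c x y \<partial>(\<mu> \<Otimes>\<^sub>M N))"
    by (rule optimal_martingale_plan_perturbation[OF opt c(1) d mart \<mu> \<rho> A \<rho>K AK N mass mean marg i2(4)])
  moreover have "(\<integral>(x, y). \<rho> (x, y) * c x y \<partial>\<pi>) = (\<integral>(x, y). \<rho> (x, y) * F (x, y) \<partial>\<pi>) +
      (\<integral>(x, y). \<rho> (x, y) * \<phi> y \<partial>\<pi>) + (\<integral>(x, y). \<rho> (x, y) * (\<psi> x * l y) \<partial>\<pi>)"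
  proof -
    have "(\<integral>(x, y). \<rho> (x, y) * c x y \<partial>\<pi>) = (\<integral>z. (case z of (x, y) \<Rightarrow> \<rho> (x, y) * F (x, y)) +
        (case z of (x, y) \<Rightarrow> \<rho> (x, y) * \<phi> y) + (case z of (x, y) \<Rightarrow> \<rho> (x, y) * (\<psi> x * l y)) \<partial>\<pi>)"
      by (rule Bochner_Integration.integral_cong) (auto simp: F_def algebra_simps)
    then show ?thesis using i1(1-3) by (simp add: split_beta')
  qed
  moreover have "(\<integral>(x, y). A (x, y) * c x y \<partial>(\<mu> \<Otimes>\<^sub>M N)) = (\<integral>(x, y). A (x, y) * F (x, y) \<partial>(\<mu> \<Otimes>\<^sub>M N)) +
      (\<integral>(x, y). A (x, y) * \<phi> y \<partial>(\<mu> \<Otimes>\<^sub>M N)) + (\<integral>(x, y). A (x, y) * (\<psi> x * l y) \<partial>(\<mu> \<Otimes>\<^sub>M N))"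
  proof -
    have "(\<integral>(x, y). A (x, y) * c x y \<partial>(\<mu> \<Otimes>\<^sub>M N)) = (\<integral>z. (case z of (x, y) \<Rightarrow> A (x, y) * F (x, y)) +
        (case z of (x, y) \<Rightarrow> A (x, y) * \<phi> y) + (case z of (x, y) \<Rightarrow> A (x, y) * (\<psi> x * l y)) \<partial>(\<mu> \<Otimes>\<^sub>M N))"
      by (rule Bochner_Integration.integral_cong) (auto simp: F_def algebra_simps)
    then show ?thesis using i2(1-3) by (simp add: split_beta')
  qed
  ultimately have le: "(\<integral>(x, y). \<rho> (x, y) * F (x, y) \<partial>\<pi>) \<le> (\<integral>(x, y). A (x, y) * F (x, y) \<partial>(\<mu> \<Otimes>\<^sub>M N))"
    by (simp add: \<phi>_eq \<psi>_eq)
  \<comment> \<open>The integral of \<open>A * F\<close> is at most 0 and that of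
    \<open>\<rho> * F\<close> at least 0, so optimality forces the latter to vanish. As
    \<open>gt\<close> is strict where \<rho> is nonzero, \<rho> would be zero almost everywhere,
    against \<open>\<rho>pos\<close>.\<close>
  have AF: "A (x, y) * F (x, y) \<le> 0" for x y
    using As[of "(x, y)"] A(2)[of "(x, y)"] lt[of x y]
    by (cases "A (x, y) = 0") (auto simp: F_def l_def intro!: mult_nonneg_nonpos)
  have \<rho>F: "0 \<le> \<rho> (x, y) * F (x, y)" "\<rho> (x, y) * F (x, y) = 0 \<Longrightarrow> \<rho> (x, y) = 0" for x y
    using \<rho>s[of "(x, y)"] \<rho>(2)[of "(x, y)"] gt[of x y]
    by (cases "\<rho> (x, y) = 0"; force simp: F_def l_def)+
  have "(\<integral>(x, y). A (x, y) * F (x, y) \<partial>(\<mu> \<Otimes>\<^sub>M N)) \<le> (\<integral>z. 0 \<partial>(\<mu> \<Otimes>\<^sub>M N))"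
    by (rule integral_mono[OF i2(1)]) (auto simp: AF)
  moreover have "0 \<le> (\<integral>(x, y). \<rho> (x, y) * F (x, y) \<partial>\<pi>)"
    by (rule integral_nonneg_AE) (auto simp: \<rho>F)
  ultimately have "(\<integral>(x, y). \<rho> (x, y) * F (x, y) \<partial>\<pi>) = 0"
    using le by simp
  then have "AE z in \<pi>. (case z of (x, y) \<Rightarrow> \<rho> (x, y) * F (x, y)) = 0"
    using i1(1) \<rho>F(1) by (subst (asm) integral_nonneg_eq_0_iff_AE) auto
  then have "AE z in \<pi>. \<rho> z = 0"
    by eventually_elim (use \<rho>F(2) in auto)
  then have "(\<integral>z. \<rho> z \<partial>\<pi>) = (\<integral>z. 0 \<partial>\<pi>)"
    by (intro integral_cong_AE) (use m\<pi> in auto)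
  with \<rho>pos show False by simp
qed

subsection \<open>Boxes of noncollinear triples\<close>

text \<open>Let t be the supremum of the points up to which \<open>B\<close> has no mass. Neither
  \<open>B\<close> below t nor the point t itself carries mass, so some \<open>t + 1 / Suc n\<close>
  still has mass of \<open>B\<close> to its right, and it has mass to its left because it exceeds
  t.\<close>

lemma atomless_split:
  fixes \<mu> :: "real measure"
  assumes \<mu>: "sets \<mu> = sets borel" and B: "B \<in> sets borel" "emeasure \<mu> B \<noteq> 0" "B \<subseteq> {u..v}"
    and atom: "\<And>x. x \<in> B \<Longrightarrow> emeasure \<mu> {x} = 0"
  obtains m where "emeasure \<mu> (B \<inter> {..<m}) \<noteq> 0" "emeasure \<mu> (B \<inter> {m<..}) \<noteq> 0"
proof -
  have [measurable]: "B \<in> sets \<mu>" "{..m} \<in> sets \<mu>" "{..<m} \<in> sets \<mu>" "{m<..} \<in> sets \<mu>" "{m} \<in> sets \<mu>"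
    for m :: real using \<mu> B by simp_all
  define S where "S = {m. emeasure \<mu> (B \<inter> {..m}) = 0}"
  define t where "t = Sup S"
  have "B \<inter> {..u - 1} = {}" using B(3) by auto
  then have "u - 1 \<in> S" by (simp add: S_def)
  have ub: "m \<le> v" if "m \<in> S" for m
  proof (rule ccontr)
    assume "\<not> m \<le> v"
    then have "B \<inter> {..m} = B" using B(3) by auto
    with that B(2) show False by (simp add: S_def)
  qed
  then have bdd: "bdd_above S" by (rule bdd_aboveI)
  have mono: "emeasure \<mu> X = 0" if "X \<subseteq> Y" "emeasure \<mu> Y = 0" "Y \<in> sets \<mu>" for X Y
    using emeasure_mono[OF that(1,3)] that(2) by simp
  have point: "emeasure \<mu> (B \<inter> {m}) = 0" for m
    using atom[of m] by (cases "m \<in> B") auto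
  have Un: "emeasure \<mu> X = 0" if "X \<subseteq> Y \<union> Z" "emeasure \<mu> Y = 0" "emeasure \<mu> Z = 0" "Y \<in> sets \<mu>" "Z \<in> sets \<mu>"
    for X Y Z
    using that emeasure_subadditive[OF that(4,5)] by - (rule mono[OF that(1)]; auto)
  have below: "emeasure \<mu> (B \<inter> {..<t}) = 0"
  proof -
    have "emeasure \<mu> (B \<inter> {..t - 1 / Suc n}) = 0" for n
    proof -
      have "t - 1 / Suc n < t" by simp
      then obtain s where "s \<in> S" "t - 1 / Suc n < s"
        using \<open>u - 1 \<in> S\<close> less_cSupD[of S "t - 1 / Suc n"] by (auto simp: t_def)
      then show ?thesis
        by - (rule mono[of _ "B \<inter> {..s}"]; auto simp: S_def)
    qed
    then have "emeasure \<mu> (\<Union>n. B \<inter> {..t - 1 / Suc n}) = 0"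
      by (intro emeasure_UN_eq_0) auto
    moreover have "B \<inter> {..<t} \<subseteq> (\<Union>n. B \<inter> {..t - 1 / Suc n})"
    proof
      fix x assume x: "x \<in> B \<inter> {..<t}"
      then have "0 < t - x" by simp
      then obtain n where "1 / Suc n < t - x"
        using reals_Archimedean[of "t - x"] by (auto simp: inverse_eq_divide)
      then have "x \<in> B \<inter> {..t - 1 / Suc n}"
        using x by simp
      then show "x \<in> (\<Union>n. B \<inter> {..t - 1 / Suc n})" by blast
    qed
    ultimately show ?thesis
      by - (rule mono, assumption, assumption, measurable)
  qed
  have "emeasure \<mu> (B \<inter> {t<..}) \<noteq> 0"
  proof
    assume "emeasure \<mu> (B \<inter> {t<..}) = 0"
    then have "emeasure \<mu> (B \<inter> {t<..} \<union> B \<inter> {t}) = 0"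
      using point[of t] by - (rule Un[of _ "B \<inter> {t<..}" "B \<inter> {t}"]; simp)
    then have "emeasure \<mu> B = 0"
      using below by - (rule Un[of B "B \<inter> {..<t}" "B \<inter> {t<..} \<union> B \<inter> {t}"]; force)
    with B(2) show False by simp
  qed
  moreover have "B \<inter> {t<..} \<subseteq> (\<Union>n. B \<inter> {t + 1 / Suc n<..})"
  proof
    fix x assume x: "x \<in> B \<inter> {t<..}"
    then have "0 < x - t" by simp
    then obtain n where "1 / Suc n < x - t"
      using reals_Archimedean[of "x - t"] by (auto simp: inverse_eq_divide)
    then have "x \<in> B \<inter> {t + 1 / Suc n<..}"
      using x by simp
    then show "x \<in> (\<Union>n. B \<inter> {t + 1 / Suc n<..})" by blast
  qed
  ultimately have "emeasure \<mu> (\<Union>n. B \<inter> {t + 1 / Suc n<..}) \<noteq> 0"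
    using mono[of "B \<inter> {t<..}" "\<Union>n. B \<inter> {t + 1 / Suc n<..}"] by auto
  moreover have "emeasure \<mu> (\<Union>n. B \<inter> {t + 1 / Suc n<..}) = 0"
    if "\<forall>n. emeasure \<mu> (B \<inter> {t + 1 / Suc n<..}) = 0"
    by (rule emeasure_UN_eq_0) (use that in auto)
  ultimately obtain n where n: "emeasure \<mu> (B \<inter> {t + 1 / Suc n<..}) \<noteq> 0"
    by blast
  define m where "m = t + 1 / Suc n"
  have "t < m" by (simp add: m_def)
  then have "m \<notin> S" using cSup_upper[OF _ bdd, of m] by (auto simp: t_def)
  then have "emeasure \<mu> (B \<inter> {..m}) \<noteq> 0" by (simp add: S_def)
  moreover have "B \<inter> {..m} \<subseteq> B \<inter> {..<m} \<union> B \<inter> {m}" by force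
  ultimately have "emeasure \<mu> (B \<inter> {..<m}) \<noteq> 0"
    using point[of m] Un[of "B \<inter> {..m}" "B \<inter> {..<m}" "B \<inter> {m}"] by auto
  with n show thesis by (intro that[of m]) (simp_all add: m_def)
qed

section \<open>Uniqueness of disintegrations and of their fibre supports\<close>

lemma disintegration_unique_AE:
  assumes d: "disintegration \<pi> \<mu> \<kappa>" "disintegration \<pi> \<mu> \<kappa>'" and \<mu>: "prob_space \<mu>" "sets \<mu> = sets borel"
    and E: "E \<in> sets borel"
  shows "AE x in \<mu>. emeasure (\<kappa> x) E = emeasure (\<kappa>' x) E"
proof -
  interpret \<mu>: prob_space \<mu> by fact
  have m: "(\<lambda>x. emeasure (k x) E) \<in> borel_measurable \<mu>" if "disintegration \<pi> \<mu> k" for k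
    using measurable_compose[OF disintegrationD(3)[OF that] measurable_emeasure_subprob_algebra[OF E]] \<mu>(2)
    by (simp cong: measurable_cong_sets)
  \<comment> \<open>Either kernel, evaluated at \<open>E\<close>, is a density with respect to \<mu>
    of the measure sending \<open>X\<close> to the \<pi>-mass of X \<times> E, and densities are
    unique up to null sets.\<close>
  have eq: "emeasure \<pi> (X \<times> E) = emeasure (density \<mu> (\<lambda>x. emeasure (k x) E)) X"
    if k: "disintegration \<pi> \<mu> k" and X: "X \<in> sets borel" for k X
  proof -
    have "emeasure \<pi> (X \<times> E) = (\<integral>\<^sup>+ x. emeasure (k x) {y. (x, y) \<in> X \<times> E} \<partial>\<mu>)"
      using k X E by (simp add: disintegration_def borel_prod[symmetric])
    also have "\<dots> = (\<integral>\<^sup>+ x. emeasure (k x) E * indicator X x \<partial>\<mu>)"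
      by (intro nn_integral_cong) (auto simp: indicator_def)
    also have "\<dots> = emeasure (density \<mu> (\<lambda>x. emeasure (k x) E)) X"
      using m[OF k] X \<mu>(2) by (simp add: emeasure_density)
    finally show ?thesis .
  qed
  have "density \<mu> (\<lambda>x. emeasure (\<kappa> x) E) = density \<mu> (\<lambda>x. emeasure (\<kappa>' x) E)"
    by (rule measure_eqI) (use \<mu>(2) eq[OF d(1)] eq[OF d(2)] in auto)
  then show ?thesis
    using \<mu>.density_unique[OF m[OF d(1)] m[OF d(2)]] by simp
qed

lemma rational_interval_in_open:
  fixes x :: real
  assumes "open U" "x \<in> U"
  obtains p q where "p \<in> \<rat>" "q \<in> \<rat>" "x \<in> {p<..<q}" "{p<..<q} \<subseteq> U"
proof -
  obtain e where e: "0 < e" "ball x e \<subseteq> U"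
    using assms open_contains_ball by blast
  obtain p where p: "p \<in> \<rat>" "x - e < p" "p < x"
    using Rats_dense_in_real[of "x - e" x] e by auto
  obtain q where q: "q \<in> \<rat>" "x < q" "q < x + e"
    using Rats_dense_in_real[of x "x + e"] e by auto
  have "{p<..<q} \<subseteq> U"
    using e(2) p q by (force simp: dist_real_def)
  with p q show thesis by (intro that[of p q]) auto
qed

text \<open>Testing the support on countably many intervals lets almost-everywhere equality of
  kernels, known for one set at a time, pass to their supports.\<close>

lemma spt_rational_intervals:
  fixes M :: "real measure"
  assumes "sets M = sets borel"
  shows "spt M = {x. \<forall>p\<in>\<rat>. \<forall>q\<in>\<rat>. x \<in> {p<..<q} \<longrightarrow> 0 < emeasure M {p<..<q}}"
proof (intro set_eqI iffI)
  fix x assume "x \<in> {x. \<forall>p\<in>\<rat>. \<forall>q\<in>\<rat>. x \<in> {p<..<q} \<longrightarrow> 0 < emeasure M {p<..<q}}"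
  then have x: "0 < emeasure M {p<..<q}" if "p \<in> \<rat>" "q \<in> \<rat>" "x \<in> {p<..<q}" for p q
    using that by blast
  have "0 < emeasure M U" if U: "open U" "x \<in> U" for U
  proof -
    obtain p q where "p \<in> \<rat>" "q \<in> \<rat>" "x \<in> {p<..<q}" "{p<..<q} \<subseteq> U"
      using rational_interval_in_open[OF U] .
    then show ?thesis
      using x[of p q] emeasure_mono[of "{p<..<q}" U M] U assms by (auto intro: less_le_trans)
  qed
  then show "x \<in> spt M" by (simp add: spt_def)
qed (auto simp: spt_def)

lemma disintegration_spt_unique_AE:
  assumes d: "disintegration \<pi> \<mu> \<kappa>" "disintegration \<pi> \<mu> \<kappa>'" and \<mu>: "prob_space \<mu>" "sets \<mu> = sets borel"
  shows "AE x in \<mu>. spt (\<kappa> x) = spt (\<kappa>' x)"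
proof -
  have "AE x in \<mu>. \<forall>p\<in>\<rat>. \<forall>q\<in>\<rat>. emeasure (\<kappa> x) {p<..<q} = emeasure (\<kappa>' x) {p<..<q}"
    by (intro AE_ball_countable' disintegration_unique_AE[OF d \<mu>] countable_rat) auto
  then show ?thesis
    by eventually_elim
      (simp add: spt_rational_intervals[OF disintegrationD(2)[OF d(1)]]
        spt_rational_intervals[OF disintegrationD(2)[OF d(2)]])
qed

text \<open>A horizontal line through a point of the graph already meets it. Positivity of
  \<open>k\<close> ensures that \<open>Suc k\<close> points have two distinct extremes, and that
  one-point supports satisfy the bound.\<close>

lemma line_intersection_bound_pos:
  assumes inter: "\<And>a b :: real. finite (graph_of (\<lambda>x. a * x + b) \<inter> graph_of f) \<and>
           card (graph_of (\<lambda>x. a * x + b) \<inter> graph_of f) \<le> k"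
  shows "0 < k"
proof -
  have "(0, f 0) \<in> graph_of (\<lambda>x. 0 * x + f 0) \<inter> graph_of f"
    by (auto simp: graph_of_def)
  then have "0 < card (graph_of (\<lambda>x. 0 * x + f 0) \<inter> graph_of f)"
    using inter[of 0 "f 0"] card_gt_0_iff by blast
  then show ?thesis using inter[of 0 "f 0"] by linarith
qed

text \<open>Take the line through the graph points above the extreme points of \<open>T\<close>. It
  cannot contain all \<open>Suc k\<close> graph points, and one off the line is necessarily above a
  point strictly between the extremes.\<close>

lemma noncollinear_triple:
  fixes f :: "real \<Rightarrow> real"
  assumes "finite T" "card T = Suc k"
    and inter: "\<And>a b :: real. finite (graph_of (\<lambda>x. a * x + b) \<inter> graph_of f) \<and>
           card (graph_of (\<lambda>x. a * x + b) \<inter> graph_of f) \<le> k"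
  obtains y0 y1 y2 a b where "y0 \<in> T" "y1 \<in> T" "y2 \<in> T" "y0 < y1" "y1 < y2"
    "f (y0 - x) = a * y0 + b" "f (y2 - x) = a * y2 + b" "f (y1 - x) \<noteq> a * y1 + b"
proof -
  have "0 < k" by (rule line_intersection_bound_pos[OF inter])
  have ne: "T \<noteq> {}" using assms by auto
  define y0 y2 where "y0 = Min T" and "y2 = Max T"
  have T: "y0 \<in> T" "y2 \<in> T" "\<And>y. y \<in> T \<Longrightarrow> y0 \<le> y" "\<And>y. y \<in> T \<Longrightarrow> y \<le> y2"
    using assms ne by (simp_all add: y0_def y2_def)
  have "y0 \<noteq> y2"
  proof
    assume "y0 = y2"
    then have "T = {y0}" using T by (auto intro: antisym)
    with assms \<open>0 < k\<close> show False by simp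
  qed
  then have lt: "y0 < y2" using T by force
  define a where "a = (f (y2 - x) - f (y0 - x)) / (y2 - y0)"
  define b where "b = f (y0 - x) - a * y0"
  have "a * (y2 - y0) = f (y2 - x) - f (y0 - x)" using lt by (simp add: a_def)
  then have ends: "f (y0 - x) = a * y0 + b" "f (y2 - x) = a * y2 + b"
    by (simp_all add: b_def algebra_simps)
  have "\<exists>y1\<in>T. f (y1 - x) \<noteq> a * y1 + b"
  proof (rule ccontr)
    assume "\<not> ?thesis"
    then have all: "f (y - x) = a * y + b" if "y \<in> T" for y using that by blast
    \<comment> \<open>The hypothesis concerns the graph of f itself, so the points are translated by
      x and the intercept is corrected by \<open>a * x\<close>.\<close>
    let ?G = "graph_of (\<lambda>z. a * z + (a * x + b)) \<inter> graph_of f"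
    have "(\<lambda>y. (y - x, f (y - x))) ` T \<subseteq> ?G"
      by (auto simp: graph_of_def all algebra_simps)
    moreover have "inj_on (\<lambda>y. (y - x, f (y - x))) T" by (auto simp: inj_on_def)
    ultimately have "card T \<le> card ?G"
      using inter[of a "a * x + b"] card_inj_on_le by blast
    with inter[of a "a * x + b"] assms(2) show False by linarith
  qed
  then obtain y1 where y1: "y1 \<in> T" "f (y1 - x) \<noteq> a * y1 + b" by blast
  then have "y1 \<noteq> y0" "y1 \<noteq> y2" using ends by auto
  then have "y0 < y1" "y1 < y2" using T y1 by (auto simp: less_le)
  with T y1 ends show thesis by (intro that) 
qed

text \<open>Reduces to \<open>optimal_martingale_plan_no_swap\<close> with the two halves of
  \<open>B\<close> as \<open>C\<close> and \<open>D\<close>, the function \<open>h (y - m)\<close>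
  as \<phi> and m - x as \<psi>.\<close>

lemma optimal_martingale_plan_box_null:
  fixes h h' :: "real \<Rightarrow> real" and c :: "real \<Rightarrow> real \<Rightarrow> real"
  assumes opt: "optimal_martingale_plan c \<mu> \<nu> \<pi>"
    and c: "integrable \<pi> (\<lambda>(x, y). c x y)" "\<And>x y. c x y = h (y - x)"
    and h: "\<And>x. (h has_real_derivative h' x) (at x)"
    and d: "disintegration \<pi> \<mu> \<kappa>"
    and mart: "AE x in \<mu>. integrable (\<kappa> x) (\<lambda>y. y) \<and> (\<integral>y. y \<partial>\<kappa> x) = x"
    and \<mu>: "prob_space \<mu>" "sets \<mu> = sets borel"
    and I: "I0 \<in> sets borel" "I1 \<in> sets borel" "I2 \<in> sets borel"
    and Isub: "I0 \<subseteq> {-K..<z1}" "I1 \<subseteq> {z1..z2}" "I2 \<subseteq> {z2<..K}"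
    and z: "-K \<le> z1" "z1 \<le> z2" "z2 \<le> K"
    and B: "B \<in> sets borel" "B \<subseteq> {u<..<v}" "\<And>x. x \<in> B \<Longrightarrow> emeasure \<mu> {x} = 0"
    and \<kappa>B: "\<And>x. x \<in> B \<Longrightarrow> emeasure (\<kappa> x) I0 \<noteq> 0" "\<And>x. x \<in> B \<Longrightarrow> emeasure (\<kappa> x) I1 \<noteq> 0"
      "\<And>x. x \<in> B \<Longrightarrow> emeasure (\<kappa> x) I2 \<noteq> 0"
    and \<sigma>: "\<sigma> = 1 \<or> \<sigma> = -1"
    and pos: "\<And>s y. s \<in> {u<..<v} \<Longrightarrow> y \<in> I1 \<Longrightarrow> 0 < \<sigma> * (h' (y - s) - (a * y + b))"
    and neg: "\<And>s y. s \<in> {u<..<v} \<Longrightarrow> y \<in> I0 \<union> I2 \<Longrightarrow> \<sigma> * (h' (y - s) - (a * y + b)) < 0"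
  shows "emeasure \<mu> B = 0"
proof (rule ccontr)
  assume "emeasure \<mu> B \<noteq> 0"
  moreover have "B \<subseteq> {u..v}" using B(2) by auto
  ultimately obtain m where m: "emeasure \<mu> (B \<inter> {..<m}) \<noteq> 0" "emeasure \<mu> (B \<inter> {m<..}) \<noteq> 0"
    using atomless_split[OF \<mu>(2) B(1) _ _ B(3)] by metis
  have "B \<inter> {..<m} \<noteq> {}" "B \<inter> {m<..} \<noteq> {}" using m by (metis emeasure_empty)+
  then have mJ: "m \<in> {u<..<v}" using B(2) by fastforce
  have hc: "continuous_on UNIV h"
    by (meson h DERIV_isCont continuous_at_imp_continuous_on)
  define R where "R = K + \<bar>u\<bar> + \<bar>v\<bar>"
  have "bounded (h ` {-R..R})"
    by (intro compact_imp_bounded compact_continuous_image continuous_on_subset[OF hc]) auto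
  then obtain M0 where M0: "\<And>z. z \<in> {-R..R} \<Longrightarrow> \<bar>h z\<bar> \<le> M0"
    unfolding bounded_real by blast
  \<comment> \<open>One constant has to bound the cost, \<phi> and \<psi>; the term
    \<open>v - u\<close> takes care of m - x.\<close>
  define M where "M = max M0 (v - u)"
  have hM: "\<bar>h (y - x)\<bar> \<le> M" if "x \<in> {u<..<v}" "y \<in> {-K..K}" for x y
  proof -
    have "y - x \<in> {-R..R}" using that by (auto simp: R_def)
    then show ?thesis using M0 by (auto simp: M_def le_max_iff_disj)
  qed
  have hm [measurable]: "h \<in> borel_measurable borel"
    using hc by (rule borel_measurable_continuous_onI)
  have cm: "(\<lambda>(x, y). c x y) \<in> borel_measurable borel"
    unfolding c(2) by (simp add: borel_prod[symmetric])
  \<comment> \<open>Mean value theorem in the first variable of the cost. The intermediate point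
    depends on x and y but stays between u and v, where \<open>pos\<close> and \<open>neg\<close>
    hold uniformly.\<close>
  have mvt: "\<exists>\<xi>\<in>{u<..<v}. c x y = h (y - m) + (m - x) * h' (y - \<xi>)" if "x \<in> {u<..<v}" for x y
  proof -
    have der: "((\<lambda>s. h (y - s)) has_real_derivative - h' (y - s)) (at s)" for s
    proof -
      have "((\<lambda>s. h (y - s)) has_real_derivative h' (y - s) * - 1) (at s)"
        by (rule DERIV_chain2[where f = h and g = "\<lambda>s. y - s"])
          (auto intro!: h derivative_eq_intros)
      then show ?thesis by simp
    qed
    consider "x < m" | "x = m" | "m < x" by linarith
    then show ?thesis
    proof cases
      case 1
      then obtain \<xi> where "x < \<xi>" "\<xi> < m" "h (y - m) - h (y - x) = (m - x) * - h' (y - \<xi>)"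
        using MVT2[of x m "\<lambda>s. h (y - s)" "\<lambda>s. - h' (y - s)"] der by blast
      then show ?thesis using that mJ by (intro bexI[of _ \<xi>]) (auto simp: c algebra_simps)
    next
      case 2
      then show ?thesis using that by (intro bexI[of _ x]) (auto simp: c)
    next
      case 3
      then obtain \<xi> where "m < \<xi>" "\<xi> < x" "h (y - x) - h (y - m) = (x - m) * - h' (y - \<xi>)"
        using MVT2[of m x "\<lambda>s. h (y - s)" "\<lambda>s. - h' (y - s)"] der by blast
      then show ?thesis using that mJ by (intro bexI[of _ \<xi>]) (auto simp: c algebra_simps)
    qed
  qed
  define G where "G x y = c x y - (h (y - m) + (m - x) * (a * y + b))" for x y
  \<comment> \<open>Multiplying by \<open>w x\<close> turns the factor m - x of \<open>G\<close>
    into its square, so the sign of \<open>w x * G x y\<close> depends only on the interval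
    containing y, not on the side of m containing x.\<close>
  define w where "w x = \<sigma> * (m - x)" for x
  have G1: "0 < w x * G x y" if x: "x \<in> {u<..<v}" "x \<noteq> m" and "y \<in> I1" for x y
  proof -
    obtain \<xi> where \<xi>: "\<xi> \<in> {u<..<v}" "c x y = h (y - m) + (m - x) * h' (y - \<xi>)"
      using mvt x by blast
    have eq: "w x * G x y = (m - x)\<^sup>2 * (\<sigma> * (h' (y - \<xi>) - (a * y + b)))"
      by (simp add: G_def w_def \<xi>(2) power2_eq_square algebra_simps)
    show ?thesis unfolding eq
      by (rule mult_pos_pos) (use pos[OF \<xi>(1) \<open>y \<in> I1\<close>] x in auto)
  qed
  have G2: "w x * G x y < 0" if x: "x \<in> {u<..<v}" "x \<noteq> m" and "y \<in> I0 \<union> I2" for x y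
  proof -
    obtain \<xi> where \<xi>: "\<xi> \<in> {u<..<v}" "c x y = h (y - m) + (m - x) * h' (y - \<xi>)"
      using mvt x by blast
    have eq: "w x * G x y = (m - x)\<^sup>2 * (\<sigma> * (h' (y - \<xi>) - (a * y + b)))"
      by (simp add: G_def w_def \<xi>(2) power2_eq_square algebra_simps)
    show ?thesis unfolding eq
      by (rule mult_pos_neg) (use neg[OF \<xi>(1) \<open>y \<in> I0 \<union> I2\<close>] x in auto)
  qed
  define C where "C = B \<inter> {x. 0 < w x}"
  define D where "D = B \<inter> {x. w x < 0}"
  \<comment> \<open>Which half is \<open>C\<close> depends on \<sigma>, hence an equality of
    unordered pairs.\<close>
  have CD: "{C, D} = {B \<inter> {..<m}, B \<inter> {m<..}}"
    using \<sigma> by (auto simp: C_def D_def w_def lessThan_def greaterThan_def)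
  have [measurable]: "C \<in> sets borel" "D \<in> sets borel"
    using B(1) by (simp_all add: C_def D_def w_def)
  have \<mu>CD: "emeasure \<mu> C \<noteq> 0" "emeasure \<mu> D \<noteq> 0"
    using CD m by (auto simp: doubleton_eq_iff)
  have CB: "x \<in> B" "x \<in> {u<..<v}" "x \<noteq> m" "0 < w x" if "x \<in> C" for x
    using that B(2) by (auto simp: C_def w_def)
  have DB: "x \<in> B" "x \<in> {u<..<v}" "x \<noteq> m" "w x < 0" if "x \<in> D" for x
    using that B(2) by (auto simp: D_def w_def)
  show False
  proof (rule optimal_martingale_plan_no_swap[OF opt c(1) cm d mart \<mu> _ _ _ \<mu>CD I Isub z])
    show "h (y - m) + (m - x) * (a * y + b) < c x y" if "(x, y) \<in> C \<times> I1 \<union> D \<times> (I0 \<union> I2)" for x y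
    proof -
      have "0 < G x y"
      proof (cases "x \<in> C")
        case True
        then have "y \<in> I1" using that by (auto simp: C_def D_def)
        then show ?thesis using G1[OF CB(2,3)[OF True]] CB(4)[OF True] by (simp add: zero_less_mult_iff)
      next
        case False
        then have *: "x \<in> D" "y \<in> I0 \<union> I2" using that by auto
        then show ?thesis using G2[OF DB(2,3)[OF *(1)] *(2)] DB(4)[OF *(1)] by (simp add: mult_less_0_iff)
      qed
      then show ?thesis by (simp add: G_def)
    qed
    show "c x y \<le> h (y - m) + (m - x) * (a * y + b)" if "(x, y) \<in> D \<times> I1 \<union> C \<times> (I0 \<union> I2)" for x y
    proof -
      have "G x y < 0"
      proof (cases "x \<in> D")
        case True
        then have "y \<in> I1" using that by (auto simp: C_def D_def)
        then show ?thesis using G1[OF DB(2,3)[OF True]] DB(4)[OF True] by (simp add: zero_less_mult_iff)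
      next
        case False
        then have *: "x \<in> C" "y \<in> I0 \<union> I2" using that by auto
        then show ?thesis using G2[OF CB(2,3)[OF *(1)] *(2)] CB(4)[OF *(1)] by (simp add: mult_less_0_iff)
      qed
      then show ?thesis by (simp add: G_def)
    qed
    show "\<bar>c x y\<bar> \<le> M" if "x \<in> C \<union> D" "y \<in> {-K..K}" for x y
      using hM[of x y] that CB(2) DB(2) by (auto simp: c)
    show "\<bar>h (y - m)\<bar> \<le> M" if "y \<in> {-K..K}" for y
      using hM[OF mJ that] .
    show "\<bar>m - x\<bar> \<le> M" if "x \<in> C \<union> D" for x
    proof -
      have "x \<in> {u<..<v}" using that CB(2) DB(2) by blast
      then show ?thesis using mJ by (auto simp: M_def abs_le_iff le_max_iff_disj)
    qed
    show "C \<inter> D = {}" by (auto simp: C_def D_def)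
    show "emeasure (\<kappa> x) I1 \<noteq> 0" if "x \<in> C" for x using \<kappa>B(2)[OF CB(1)[OF that]] .
    show "emeasure (\<kappa> x) I0 \<noteq> 0" "emeasure (\<kappa> x) I2 \<noteq> 0" if "x \<in> D" for x
      using \<kappa>B(1,3)[OF DB(1)[OF that]] .
  qed simp_all
qed

text \<open>Equality at the outer points is not stable under perturbation. After moving the line
  halfway towards the middle point all three relations are strict, hence hold on open boxes, which
  contain rational ones.\<close>

lemma rational_box_around_noncollinear_triple:
  fixes f :: "real \<Rightarrow> real"
  assumes f: "continuous_on UNIV f" and lt: "y0 < y1" "y1 < y2"
    and y: "f (y0 - x) = a * y0 + b" "f (y2 - x) = a * y2 + b" "f (y1 - x) \<noteq> a * y1 + b"
  obtains u v p0 q0 p1 q1 p2 q2 z1 z2 \<sigma> b'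
  where "u \<in> \<rat>" "v \<in> \<rat>" "p0 \<in> \<rat>" "q0 \<in> \<rat>" "p1 \<in> \<rat>" "q1 \<in> \<rat>" "p2 \<in> \<rat>" "q2 \<in> \<rat>"
    and "x \<in> {u<..<v}" "y0 \<in> {p0<..<q0}" "y1 \<in> {p1<..<q1}" "y2 \<in> {p2<..<q2}"
    and "{p0<..<q0} \<subseteq> {..<z1}" "{p1<..<q1} \<subseteq> {z1..z2}" "{p2<..<q2} \<subseteq> {z2<..}" "z1 \<le> z2"
    and "\<sigma> = 1 \<or> \<sigma> = -1"
    and "\<forall>s\<in>{u<..<v}. \<forall>y\<in>{p1<..<q1}. 0 < \<sigma> * (f (y - s) - (a * y + b'))"
    and "\<forall>s\<in>{u<..<v}. \<forall>y\<in>{p0<..<q0} \<union> {p2<..<q2}. \<sigma> * (f (y - s) - (a * y + b')) < 0"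
proof -
  define \<delta> where "\<delta> = f (y1 - x) - (a * y1 + b)"
  define \<sigma> :: real where "\<sigma> = sgn \<delta>"
  have \<delta>: "\<delta> \<noteq> 0" "\<sigma> = 1 \<or> \<sigma> = -1" "0 < \<sigma> * \<delta>"
    using y(3) by (auto simp: \<delta>_def \<sigma>_def sgn_if)
  \<comment> \<open>At the middle point the deviation from the new line is \<delta> / 2, at both
    outer points -\<delta> / 2.\<close>
  define b' where "b' = b + \<delta> / 2"
  define H where "H = (\<lambda>z. \<sigma> * (f (snd z - fst z) - (a * snd z + b')))"
  have Hc: "continuous_on UNIV H"
    unfolding H_def by (intro continuous_intros continuous_on_compose2[OF f]) auto
  have "H (x, y1) = \<sigma> * \<delta> / 2" "H (x, y0) = - (\<sigma> * \<delta> / 2)" "H (x, y2) = - (\<sigma> * \<delta> / 2)"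
    using y(1,2) by (simp_all add: H_def b'_def \<delta>_def field_simps)
  then have H: "0 < H (x, y1)" "H (x, y0) < 0" "H (x, y2) < 0"
    using \<delta>(3) by simp_all
  have o: "open {p. 0 < H p}" "open {p. H p < 0}"
    by (intro open_Collect_less Hc continuous_on_const)+
  have rect: "\<exists>U V. open U \<and> open V \<and> x \<in> U \<and> y \<in> V \<and> U \<times> V \<subseteq> W" if "open W" "(x, y) \<in> W" for y W
    using that by (metis open_prod_elim mem_Sigma_iff)
  obtain U1 V1 where 1: "open U1" "open V1" "x \<in> U1" "y1 \<in> V1" "U1 \<times> V1 \<subseteq> {p. 0 < H p}"
    using rect[OF o(1), of y1] H by auto
  obtain U0 V0 where 0: "open U0" "open V0" "x \<in> U0" "y0 \<in> V0" "U0 \<times> V0 \<subseteq> {p. H p < 0}"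
    using rect[OF o(2), of y0] H by auto
  obtain U2 V2 where 2: "open U2" "open V2" "x \<in> U2" "y2 \<in> V2" "U2 \<times> V2 \<subseteq> {p. H p < 0}"
    using rect[OF o(2), of y2] H by auto
  define z1 z2 where "z1 = (y0 + y1) / 2" and "z2 = (y1 + y2) / 2"
  have nbhd: "open (U0 \<inter> U1 \<inter> U2)" "x \<in> U0 \<inter> U1 \<inter> U2" "open (V0 \<inter> {..<z1})" "y0 \<in> V0 \<inter> {..<z1}"
    "open (V1 \<inter> {z1<..<z2})" "y1 \<in> V1 \<inter> {z1<..<z2}" "open (V2 \<inter> {z2<..})" "y2 \<in> V2 \<inter> {z2<..}"
    using 0(1-4) 1(1-4) 2(1-4) lt by (auto simp: z1_def z2_def)
  obtain u v where u: "u \<in> \<rat>" "v \<in> \<rat>" "x \<in> {u<..<v}" "{u<..<v} \<subseteq> U0 \<inter> U1 \<inter> U2"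
    using rational_interval_in_open[OF nbhd(1,2)] .
  obtain p0 q0 where p0: "p0 \<in> \<rat>" "q0 \<in> \<rat>" "y0 \<in> {p0<..<q0}" "{p0<..<q0} \<subseteq> V0 \<inter> {..<z1}"
    using rational_interval_in_open[OF nbhd(3,4)] .
  obtain p1 q1 where p1: "p1 \<in> \<rat>" "q1 \<in> \<rat>" "y1 \<in> {p1<..<q1}" "{p1<..<q1} \<subseteq> V1 \<inter> {z1<..<z2}"
    using rational_interval_in_open[OF nbhd(5,6)] .
  obtain p2 q2 where p2: "p2 \<in> \<rat>" "q2 \<in> \<rat>" "y2 \<in> {p2<..<q2}" "{p2<..<q2} \<subseteq> V2 \<inter> {z2<..}"
    using rational_interval_in_open[OF nbhd(7,8)] .
  show thesis
  proof (rule that[OF u(1,2) p0(1,2) p1(1,2) p2(1,2) u(3) p0(3) p1(3) p2(3) _ _ _ _ \<delta>(2)])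
    show "{p0<..<q0} \<subseteq> {..<z1}" using p0(4) by blast
    show "{p1<..<q1} \<subseteq> {z1..z2}" using p1(4) by fastforce
    show "{p2<..<q2} \<subseteq> {z2<..}" using p2(4) by blast
    show "z1 \<le> z2" using lt by (simp add: z1_def z2_def)
    show "\<forall>s\<in>{u<..<v}. \<forall>y\<in>{p1<..<q1}. 0 < \<sigma> * (f (y - s) - (a * y + b'))"
    proof (intro ballI)
      fix s y assume "s \<in> {u<..<v}" "y \<in> {p1<..<q1}"
      then have "(s, y) \<in> U1 \<times> V1" using u(4) p1(4) by blast
      then have "0 < H (s, y)" using 1(5) by blast
      then show "0 < \<sigma> * (f (y - s) - (a * y + b'))" by (simp add: H_def)
    qed
    show "\<forall>s\<in>{u<..<v}. \<forall>y\<in>{p0<..<q0} \<union> {p2<..<q2}. \<sigma> * (f (y - s) - (a * y + b')) < 0"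
    proof (intro ballI)
      fix s y assume "s \<in> {u<..<v}" "y \<in> {p0<..<q0} \<union> {p2<..<q2}"
      then have "(s, y) \<in> U0 \<times> V0 \<union> U2 \<times> V2" using u(4) p0(4) p2(4) by blast
      then have "H (s, y) < 0" using 0(5) 2(5) by blast
      then show "\<sigma> * (f (y - s) - (a * y + b')) < 0" by (simp add: H_def)
    qed
  qed
qed

lemma optimal_martingale_plan_card_spt:
  fixes h h' :: "real \<Rightarrow> real" and c :: "real \<Rightarrow> real \<Rightarrow> real"
  assumes opt: "optimal_martingale_plan c \<mu> \<nu> \<pi>"
    and c: "integrable \<pi> (\<lambda>(x, y). c x y)" "\<And>x y. c x y = h (y - x)"
    and h: "\<And>x. (h has_real_derivative h' x) (at x)" "continuous_on UNIV h'"
    and inter: "\<And>a b :: real. finite (graph_of (\<lambda>x. a * x + b) \<inter> graph_of h') \<and>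
           card (graph_of (\<lambda>x. a * x + b) \<inter> graph_of h') \<le> k"
    and d: "disintegration \<pi> \<mu> \<kappa>"
    and mart: "AE x in \<mu>. integrable (\<kappa> x) (\<lambda>y. y) \<and> (\<integral>y. y \<partial>\<kappa> x) = x"
    and \<mu>: "prob_space \<mu>" "sets \<mu> = sets borel"
  shows "AE x in \<mu>. 0 < emeasure \<mu> {x} \<or> (finite (spt (\<kappa> x)) \<and> card (spt (\<kappa> x)) \<le> k)"
proof -
  interpret \<mu>: prob_space \<mu> by fact
  \<comment> \<open>The line, the sign and the separators are existentially quantified: only the
    eight interval endpoints index a box, and with rational endpoints there are countably many,
    although the lines are arbitrary.\<close>
  define good where "good = (\<lambda>(u, v, p0, q0, p1, q1, p2, q2 :: real). \<exists>a b \<sigma> z1 z2. (\<sigma> = 1 \<or> \<sigma> = -1) \<and>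
      {p0<..<q0} \<subseteq> {..<z1} \<and> {p1<..<q1} \<subseteq> {z1..z2} \<and> {p2<..<q2} \<subseteq> {z2<..} \<and> z1 \<le> z2 \<and>
      (\<forall>s\<in>{u<..<v}. \<forall>y\<in>{p1<..<q1}. 0 < \<sigma> * (h' (y - s) - (a * y + b))) \<and>
      (\<forall>s\<in>{u<..<v}. \<forall>y\<in>{p0<..<q0} \<union> {p2<..<q2}. \<sigma> * (h' (y - s) - (a * y + b)) < 0))"
  define Box where "Box = (\<lambda>(u, v, p0, q0, p1, q1, p2, q2 :: real). {x \<in> {u<..<v}. emeasure \<mu> {x} = 0 \<and>
      emeasure (\<kappa> x) {p0<..<q0} \<noteq> 0 \<and> emeasure (\<kappa> x) {p1<..<q1} \<noteq> 0 \<and> emeasure (\<kappa> x) {p2<..<q2} \<noteq> 0})"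
  \<comment> \<open>A finite measure has at most countably many atoms, so the atoms, and with them
    the boxes, form Borel sets.\<close>
  have cnt: "countable {x. emeasure \<mu> {x} \<noteq> 0}"
    using \<mu>.countable_support by (simp add: measure_def enn2real_eq_0_iff)
  then have "{x. emeasure \<mu> {x} \<noteq> 0} \<in> sets borel"
    by (rule sets.countable[rotated]) simp
  then have atoms: "{x. emeasure \<mu> {x} = 0} \<in> sets borel"
    using sets.compl_sets[of "{x. emeasure \<mu> {x} \<noteq> 0}" borel]
    by (simp add: Compl_eq_Diff_UNIV[symmetric] Collect_neg_eq[symmetric])
  have m\<kappa>: "{x. emeasure (\<kappa> x) E \<noteq> 0} \<in> sets borel" if [measurable]: "E \<in> sets borel" for E
  proof -
    have [measurable]: "(\<lambda>x. emeasure (\<kappa> x) E) \<in> borel_measurable borel"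
      by (rule measurable_compose[OF disintegrationD(3)[OF d] measurable_emeasure_subprob_algebra]) simp
    show ?thesis by measurable
  qed
  have Box_sets: "Box \<beta> \<in> sets borel" for \<beta>
  proof -
    obtain u v p0 q0 p1 q1 p2 q2 where \<beta>: "\<beta> = (u, v, p0, q0, p1, q1, p2, q2)" by (metis surj_pair)
    have "Box \<beta> = {u<..<v} \<inter> {x. emeasure \<mu> {x} = 0} \<inter> {x. emeasure (\<kappa> x) {p0<..<q0} \<noteq> 0} \<inter>
        {x. emeasure (\<kappa> x) {p1<..<q1} \<noteq> 0} \<inter> {x. emeasure (\<kappa> x) {p2<..<q2} \<noteq> 0}"
      by (auto simp: Box_def \<beta>)
    also have "\<dots> \<in> sets borel" by (intro sets.Int m\<kappa> atoms) auto
    finally show ?thesis .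
  qed
  have null: "AE x in \<mu>. x \<notin> Box \<beta>" if "good \<beta>" for \<beta>
  proof -
    obtain u v p0 q0 p1 q1 p2 q2 where \<beta>: "\<beta> = (u, v, p0, q0, p1, q1, p2, q2)" by (metis surj_pair)
    from that obtain a b \<sigma> z1 z2 where g: "\<sigma> = 1 \<or> \<sigma> = -1"
      "{p0<..<q0} \<subseteq> {..<z1}" "{p1<..<q1} \<subseteq> {z1..z2}" "{p2<..<q2} \<subseteq> {z2<..}" "z1 \<le> z2"
      "\<And>s y. s \<in> {u<..<v} \<Longrightarrow> y \<in> {p1<..<q1} \<Longrightarrow> 0 < \<sigma> * (h' (y - s) - (a * y + b))"
      "\<And>s y. s \<in> {u<..<v} \<Longrightarrow> y \<in> {p0<..<q0} \<union> {p2<..<q2} \<Longrightarrow> \<sigma> * (h' (y - s) - (a * y + b)) < 0"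
      unfolding good_def \<beta> by (simp only: prod.case) blast
    \<comment> \<open>Large enough for the outer ends \<open>p0\<close> and \<open>q2\<close> of the
      intervals as well as for both separators.\<close>
    define K where "K = \<bar>p0\<bar> + \<bar>q2\<bar> + \<bar>z1\<bar> + \<bar>z2\<bar>"
    have "emeasure \<mu> (Box \<beta>) = 0"
    proof (rule optimal_martingale_plan_box_null[OF opt c h(1) d mart \<mu> _ _ _ _ g(3) _ _ g(5) _ Box_sets _ _ _ _ _ g(1,6,7)])
      show "{p0<..<q0} \<subseteq> {-K..<z1}" using g(2) by (force simp: K_def)
      show "{p2<..<q2} \<subseteq> {z2<..K}" using g(4) by (force simp: K_def)
      show "-K \<le> z1" "z2 \<le> K" by (auto simp: K_def)
    qed (auto simp: Box_def \<beta>)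
    then show ?thesis
      using AE_iff_null_sets[of "Box \<beta>" \<mu>] Box_sets \<mu>(2) by (auto simp: null_sets_def)
  qed
  let ?Q = "\<rat> \<times> \<rat> \<times> \<rat> \<times> \<rat> \<times> \<rat> \<times> \<rat> \<times> \<rat> \<times> (\<rat> :: real set)"
  have "countable ?Q" by (intro countable_SIGMA countable_rat)
  then have "AE x in \<mu>. \<forall>\<beta>\<in>?Q. good \<beta> \<longrightarrow> x \<notin> Box \<beta>"
    by (rule AE_ball_countable[THEN iffD2]) (use null in auto)
  then show ?thesis
  proof eventually_elim
    case (elim x)
    show ?case
    proof (rule ccontr)
      assume "\<not> ?case"
      then have x: "emeasure \<mu> {x} = 0" and big: "infinite (spt (\<kappa> x)) \<or> Suc k \<le> card (spt (\<kappa> x))"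
        by (auto simp: not_le)
      \<comment> \<open>An infinite support has \<open>card\<close> 0 by convention, so it is
        treated apart from a finite one with too many points.\<close>
      obtain T where T: "T \<subseteq> spt (\<kappa> x)" "finite T" "card T = Suc k"
      proof (cases "finite (spt (\<kappa> x))")
        case True
        then have "Suc k \<le> card (spt (\<kappa> x))" using big by simp
        then show thesis by (rule obtain_subset_with_card_n) (rule that)
      next
        case False
        then have "\<exists>T. finite T \<and> card T = Suc k \<and> T \<subseteq> spt (\<kappa> x)"
          by (rule infinite_arbitrarily_large)
        then show thesis by (elim exE conjE) (rule that)
      qed
      obtain y0 y1 y2 a b where y: "y0 \<in> T" "y1 \<in> T" "y2 \<in> T" "y0 < y1" "y1 < y2"
        "h' (y0 - x) = a * y0 + b" "h' (y2 - x) = a * y2 + b" "h' (y1 - x) \<noteq> a * y1 + b"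
        using noncollinear_triple[OF T(2,3) inter, where x = x] .
      obtain u v p0 q0 p1 q1 p2 q2 b' \<sigma> z1 z2
        where rat: "u \<in> \<rat>" "v \<in> \<rat>" "p0 \<in> \<rat>" "q0 \<in> \<rat>" "p1 \<in> \<rat>" "q1 \<in> \<rat>" "p2 \<in> \<rat>" "q2 \<in> \<rat>"
          and mem: "x \<in> {u<..<v}" "y0 \<in> {p0<..<q0}" "y1 \<in> {p1<..<q1}" "y2 \<in> {p2<..<q2}"
          and sep: "{p0<..<q0} \<subseteq> {..<z1}" "{p1<..<q1} \<subseteq> {z1..z2}" "{p2<..<q2} \<subseteq> {z2<..}" "z1 \<le> z2"
          and \<sigma>: "\<sigma> = 1 \<or> \<sigma> = -1"
          and gt: "\<forall>s\<in>{u<..<v}. \<forall>y\<in>{p1<..<q1}. 0 < \<sigma> * (h' (y - s) - (a * y + b'))"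
          and lt: "\<forall>s\<in>{u<..<v}. \<forall>y\<in>{p0<..<q0} \<union> {p2<..<q2}. \<sigma> * (h' (y - s) - (a * y + b')) < 0"
        using rational_box_around_noncollinear_triple[OF h(2) y(4-8)] .
      define \<beta> where "\<beta> = (u, v, p0, q0, p1, q1, p2, q2)"
      have "\<beta> \<in> ?Q" using rat by (simp add: \<beta>_def)
      moreover have "good \<beta>"
        unfolding good_def \<beta>_def prod.case
        by (intro exI[of _ a] exI[of _ b'] exI[of _ \<sigma>] exI[of _ z1] exI[of _ z2] conjI \<sigma> sep gt lt)
      moreover have "x \<in> Box \<beta>"
      proof -
        have "emeasure (\<kappa> x) {p<..<q} \<noteq> 0" if "y \<in> T" "y \<in> {p<..<q}" for y p q
          using that T(1) by (force simp: spt_def)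
        then show ?thesis using mem y(1-3) x by (auto simp: Box_def \<beta>_def)
      qed
      ultimately show False using elim by blast
    qed
  qed
qed

subsection \<open>The bound on the support\<close>

text \<open>Dirac measures serve as harmless fibres on the exceptional null set.\<close>

lemma spt_return: "spt (return borel (x :: real)) = {x}"
proof -
  have "\<exists>U. open U \<and> y \<in> U \<and> x \<notin> U" if "y \<noteq> x" for y
    using that by (intro exI[of _ "- {x}"]) auto
  then show ?thesis
    by (fastforce simp: spt_def indicator_def)
qed

theorem theorem7p1:
  fixes \<mu> \<nu> :: "real measure"
    and h :: "real \<Rightarrow> real"
    and c :: "real \<Rightarrow> real \<Rightarrow> real"
    and k :: nat
    and \<pi> :: "(real \<times> real) measure"
  assumes "prob_space \<mu>" and "sets \<mu> = sets borel"
    and "prob_space \<nu>" and "sets \<nu> = sets borel"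
    and "convex_order \<mu> \<nu>"
    and "twice_continuously_differentiable h"
    and "\<And>x y. c x y = h (y - x)"
    and "sufficient_integrability c \<mu> \<nu>"
    and "\<And>a b :: real. finite (graph_of (\<lambda>x. a * x + b) \<inter> graph_of (deriv h)) \<and>
           card (graph_of (\<lambda>x. a * x + b) \<inter> graph_of (deriv h)) \<le> k"
    and "optimal_martingale_plan c \<mu> \<nu> \<pi>"
    and "\<bar>transport_cost c \<pi>\<bar> \<noteq> \<infinity>"
  shows "(\<exists>\<kappa>. disintegration \<pi> \<mu> \<kappa> \<and>
            (\<forall>x. emeasure \<mu> {x} > 0 \<or> (finite (spt (\<kappa> x)) \<and> card (spt (\<kappa> x)) \<le> k))) \<and>
         ((\<forall>x. emeasure \<mu> {x} = 0) \<longrightarrow>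
            (\<forall>\<kappa>. disintegration \<pi> \<mu> \<kappa> \<longrightarrow>
               (AE x in \<mu>. finite (spt (\<kappa> x)) \<and> card (spt (\<kappa> x)) \<le> k)))"
proof -
  note \<mu> = assms(1,2) and c_eq = assms(7) and inter = assms(9) and opt = assms(10)
  have diff: "h differentiable (at x)" "deriv h differentiable (at x)" for x
    using assms(6) by (auto simp: twice_continuously_differentiable_def differentiable_on_def)
  then have h: "(h has_real_derivative deriv h x) (at x)" for x
    by (simp add: DERIV_deriv_iff_real_differentiable)
  have h': "continuous_on UNIV (deriv h)"
    using diff(2) by (intro continuous_at_imp_continuous_on ballI differentiable_imp_continuous_within)
  have [measurable]: "h \<in> borel_measurable borel"
    by (intro borel_measurable_continuous_onI continuous_at_imp_continuous_on ballI
        differentiable_imp_continuous_within diff)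
  have s\<pi>: "sets \<pi> = sets borel"
    using opt by (auto simp: optimal_martingale_plan_def martingale_plans_def)
  have "(\<lambda>(x, y). c x y) \<in> borel_measurable \<pi>"
    unfolding measurable_cong_sets[OF s\<pi> refl] c_eq by (simp add: borel_prod[symmetric])
  then have c: "integrable \<pi> (\<lambda>(x, y). c x y)"
    using assms(11) unfolding transport_cost_def by (rule integrable_of_ext_integral_finite)
  obtain \<kappa>0 where d0: "disintegration \<pi> \<mu> \<kappa>0"
    and mart: "AE x in \<mu>. integrable (\<kappa>0 x) (\<lambda>y. y) \<and> (\<integral>y. y \<partial>\<kappa>0 x) = x"
    using opt by (auto simp: optimal_martingale_plan_def martingale_plans_def)
  define P where "P \<kappa> x \<longleftrightarrow> 0 < emeasure \<mu> {x} \<or> (finite (spt (\<kappa> x)) \<and> card (spt (\<kappa> x)) \<le> k)"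
    for \<kappa> :: "real \<Rightarrow> real measure" and x
  have P0: "AE x in \<mu>. P \<kappa>0 x"
    unfolding P_def by (rule optimal_martingale_plan_card_spt[OF opt c c_eq h h' inter d0 mart \<mu>])
  have "0 < k" by (rule line_intersection_bound_pos[OF inter])
  obtain Z where Z: "{x \<in> space \<mu>. \<not> P \<kappa>0 x} \<subseteq> Z" "emeasure \<mu> Z = 0" "Z \<in> sets \<mu>"
    using AE_E[OF P0] .
  then have [measurable]: "Z \<in> sets borel" and sp: "space \<mu> = UNIV"
    using \<mu>(2) sets_eq_imp_space_eq[OF \<mu>(2)] by simp_all
  \<comment> \<open>The bound is claimed for every x, so the kernel is changed on a Borel null set
    covering all failures. Its new fibres have one-point supports, which is enough as 0 < k.\<close>
  define \<kappa>1 where "\<kappa>1 x = (if x \<in> Z then return borel x else \<kappa>0 x)" for x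
  have "AE x in \<mu>. x \<notin> Z"
    using Z(2,3) by (intro AE_not_in) (simp add: null_sets_def)
  then have eq: "AE x in \<mu>. \<kappa>1 x = \<kappa>0 x"
    by eventually_elim (simp add: \<kappa>1_def)
  have "disintegration \<pi> \<mu> \<kappa>1"
    unfolding disintegration_def
  proof (intro conjI ballI)
    show "\<kappa>1 \<in> borel \<rightarrow>\<^sub>M prob_algebra borel"
      unfolding \<kappa>1_def[abs_def]
      by (rule measurable_If_set) (use d0 in \<open>auto simp: disintegration_def\<close>)
    fix S :: "(real \<times> real) set" assume "S \<in> sets borel"
    then have "emeasure \<pi> S = (\<integral>\<^sup>+ x. emeasure (\<kappa>0 x) {y. (x, y) \<in> S} \<partial>\<mu>)"
      using d0 by (simp add: disintegration_def)
    also have "\<dots> = (\<integral>\<^sup>+ x. emeasure (\<kappa>1 x) {y. (x, y) \<in> S} \<partial>\<mu>)"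
      by (rule nn_integral_cong_AE) (use eq in eventually_elim, simp)
    finally show "emeasure \<pi> S = (\<integral>\<^sup>+ x. emeasure (\<kappa>1 x) {y. (x, y) \<in> S} \<partial>\<mu>)" .
  qed
  moreover have "P \<kappa>1 x" for x
    using Z(1) sp \<open>0 < k\<close> by (cases "x \<in> Z") (auto simp: \<kappa>1_def P_def spt_return)
  \<comment> \<open>A prescribed kernel has almost everywhere the same supports as
    \<open>\<kappa>0\<close> and inherits the bound from it up to a null set.\<close>
  moreover have "AE x in \<mu>. finite (spt (\<kappa> x)) \<and> card (spt (\<kappa> x)) \<le> k"
    if "\<forall>x. emeasure \<mu> {x} = 0" "disintegration \<pi> \<mu> \<kappa>" for \<kappa>
    using disintegration_spt_unique_AE[OF that(2) d0 \<mu>] P0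
    by eventually_elim (use that(1) in \<open>simp add: P_def\<close>)
  ultimately show ?thesis unfolding P_def by blast
qed

end
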